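(* Let $k$ and $n$ be positive integers with $n\geq 10^{46}k$, and let $x_1,\dots,x_n$ be real numbers such that $x_1+\dots+x_n\geq 0$. Then at least $\binom{n-1}{k-1}$ subsets $A\subseteq\{1,\dots,n\}$ with $|A|=k$ satisfy $\sum_{a\in A}x_a\geq 0$. *)

theory Defs imports Complex_Main begin

end

theory Submission imports Defs "HOL-Combinatorics.Permutations" begin

text \<open>
  Write \<open>S\<close> for the sum over a uniformly random set of the indicated size, and let \<open>z\<close> be an index with
  \<open>x z\<close> maximal.

  \<^bold>\<open>Dichotomy.\<close> Discard the \<open>n/(2k)\<close> smallest numbers; a random \<open>k\<close>-set avoids them with probability at
  least \<open>1/2\<close>. The others lie in an interval \<open>[-Q, x z]\<close> and have sum at least \<open>n Q/(2k)\<close>, so the mean of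
  \<open>S\<close> is of order at least \<open>Q\<close>. A second and fourth moment estimate for sampling without replacement
  then shows that either \<open>S \<ge> 0\<close> for \<open>k\<close>-sets, or \<open>x z + S \<ge> 0\<close> for \<open>(k-1)\<close>-sets, holds with
  probability bounded below by an absolute constant. In the first case we are done.

  \<^bold>\<open>Removing the maximum.\<close> Otherwise call a \<open>(k-1)\<close>-set \<open>T\<close> avoiding \<open>z\<close> bad if \<open>x z + x(T) < 0\<close>, and
  let \<open>q\<close> be the probability of this, so that \<open>1 - q\<close> is bounded below. It suffices that a random
  \<open>k\<close>-set avoiding \<open>z\<close> is nonnegative with probability at least \<open>q k/(n - k)\<close>. If \<open>T\<close> is bad, the
  remaining \<open>n - k\<close> numbers have positive sum; cut them into \<open>M\<close> blocks of size \<open>k\<close> and a rest of size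
  about \<open>1000 k\<close>. One block is nonnegative, or else the rest is, and by the dichotomy a nonnegative rest
  contains a constant proportion of nonnegative \<open>k\<close>-sets. So a bad \<open>T\<close> forces a nonnegative \<open>k\<close>-set
  disjoint from it with probability about \<open>1/M\<close>, up to a factor \<open>1 - O(1/M)\<close>. This loss is recovered by
  using a second \<open>(k-1)\<close>-set \<open>T'\<close> disjoint from \<open>T\<close>: with probability at least \<open>q (1 - q)/2\<close> only \<open>T\<close>
  is bad, so \<open>T\<close> and \<open>T'\<close> together force more nonnegative \<open>k\<close>-sets by a constant factor.
\<close>

section \<open>Uniformly random permutations\<close>

text \<open>A random k-set is encoded as the image of a fixed k-set of positions under a random
  permutation. Several disjoint random sets then live on one probability space, and symmetry
  arguments become composition with a permutation.\<close>

definition perm_avg :: "'a set \<Rightarrow> (('a \<Rightarrow> 'a) \<Rightarrow> real) \<Rightarrow> real" where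
  "perm_avg V f = (\<Sum>\<pi> | \<pi> permutes V. f \<pi>) / fact (card V)"

abbreviation perm_prob :: "'a set \<Rightarrow> (('a \<Rightarrow> 'a) \<Rightarrow> bool) \<Rightarrow> real" where
  "perm_prob V P \<equiv> perm_avg V (\<lambda>\<pi>. of_bool (P \<pi>))"

lemma perm_avg_add: "perm_avg V (\<lambda>\<pi>. f \<pi> + g \<pi>) = perm_avg V f + perm_avg V g"
  by (simp add: perm_avg_def sum.distrib add_divide_distrib)

lemma perm_avg_diff: "perm_avg V (\<lambda>\<pi>. f \<pi> - g \<pi>) = perm_avg V f - perm_avg V g"
  by (simp add: perm_avg_def sum_subtractf diff_divide_distrib)

lemma perm_avg_cmult: "perm_avg V (\<lambda>\<pi>. c * f \<pi>) = c * perm_avg V f"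
  by (simp add: perm_avg_def sum_distrib_left)

lemma perm_avg_sum: "perm_avg V (\<lambda>\<pi>. \<Sum>i\<in>I. f i \<pi>) = (\<Sum>i\<in>I. perm_avg V (f i))"
  unfolding perm_avg_def by (subst sum.swap) (simp add: sum_divide_distrib)

lemma perm_avg_const:
  assumes "finite V"
  shows "perm_avg V (\<lambda>\<pi>. c) = c"
  using card_permutations[OF refl assms] by (simp add: perm_avg_def)

lemma perm_avg_mono:
  assumes "\<And>\<pi>. \<pi> permutes V \<Longrightarrow> f \<pi> \<le> g \<pi>"
  shows "perm_avg V f \<le> perm_avg V g"
  unfolding perm_avg_def using assms by (intro divide_right_mono sum_mono) auto

lemma perm_avg_cong:
  assumes "\<And>\<pi>. \<pi> permutes V \<Longrightarrow> f \<pi> = g \<pi>"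
  shows "perm_avg V f = perm_avg V g"
  unfolding perm_avg_def using assms by (intro arg_cong2[where f="(/)"] sum.cong) auto

lemma perm_avg_nonneg:
  assumes "\<And>\<pi>. \<pi> permutes V \<Longrightarrow> 0 \<le> f \<pi>"
  shows "0 \<le> perm_avg V f"
  unfolding perm_avg_def using assms by (intro divide_nonneg_pos sum_nonneg) auto

lemma perm_prob_mono:
  assumes "\<And>\<pi>. \<pi> permutes V \<Longrightarrow> P \<pi> \<Longrightarrow> R \<pi>"
  shows "perm_prob V P \<le> perm_prob V R"
  using assms by (intro perm_avg_mono) (auto simp: of_bool_def)

lemma perm_prob_not:
  assumes "finite V"
  shows "perm_prob V (\<lambda>\<pi>. \<not> P \<pi>) = 1 - perm_prob V P"
  by (simp add: of_bool_not_iff perm_avg_diff perm_avg_const[OF assms])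

lemma perm_avg_swap:
  "perm_avg V (\<lambda>\<tau>. perm_avg V (\<lambda>\<pi>. f \<tau> \<pi>)) = perm_avg V (\<lambda>\<pi>. perm_avg V (\<lambda>\<tau>. f \<tau> \<pi>))"
  unfolding perm_avg_def sum_divide_distrib[symmetric] by (subst sum.swap) simp

lemma perm_avg_compose_left:
  assumes "\<sigma> permutes V"
  shows "perm_avg V (\<lambda>\<pi>. f (\<sigma> \<circ> \<pi>)) = perm_avg V f"
proof -
  have "(\<Sum>\<pi> | \<pi> permutes V. f (\<sigma> \<circ> \<pi>)) = (\<Sum>\<pi> | \<pi> permutes V. f \<pi>)"
  proof (rule sum.reindex_bij_witness[where i="\<lambda>\<pi>. inv \<sigma> \<circ> \<pi>" and j="\<lambda>\<pi>. \<sigma> \<circ> \<pi>"])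
  qed (simp_all add: permutes_inv_o[OF assms] permutes_compose permutes_inv assms flip: comp_assoc)
  then show ?thesis by (simp add: perm_avg_def)
qed

lemma perm_avg_compose_right:
  assumes "\<sigma> permutes V"
  shows "perm_avg V (\<lambda>\<pi>. f (\<pi> \<circ> \<sigma>)) = perm_avg V f"
proof -
  have "(\<Sum>\<pi> | \<pi> permutes V. f (\<pi> \<circ> \<sigma>)) = (\<Sum>\<pi> | \<pi> permutes V. f \<pi>)"
  proof (rule sum.reindex_bij_witness[where i="\<lambda>\<pi>. \<pi> \<circ> inv \<sigma>" and j="\<lambda>\<pi>. \<pi> \<circ> \<sigma>"])
  qed (simp_all add: comp_assoc permutes_inv_o[OF assms] permutes_compose permutes_inv assms)
  then show ?thesis by (simp add: perm_avg_def)
qed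

text \<open>Equal cardinalities give bijections between the first sets, the second sets and the two
  complements in \<open>V\<close>. They are glued together and extended by the identity outside
  \<open>V\<close>.\<close>

lemma permutes_map_disjoint_pair:
  assumes "finite V" "A \<subseteq> V" "B \<subseteq> V" "A \<inter> B = {}" "A' \<subseteq> V" "B' \<subseteq> V" "A' \<inter> B' = {}"
    and "card A = card A'" "card B = card B'"
  obtains \<sigma> where "\<sigma> permutes V" "\<sigma> ` A = A'" "\<sigma> ` B = B'"
proof -
  have fin: "finite A" "finite B" "finite A'" "finite B'"
    using assms finite_subset by blast+
  define C where "C = V - (A \<union> B)"
  define C' where "C' = V - (A' \<union> B')"
  have "card C = card C'"
    using assms fin unfolding C_def C'_def
    by (simp add: card_Diff_subset card_Un_disjoint)
  moreover have "finite C" "finite C'" using assms by (auto simp: C_def C'_def)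
  ultimately obtain f g h where f: "bij_betw f A A'" and g: "bij_betw g B B'" and h: "bij_betw h C C'"
    using fin assms finite_same_card_bij by metis
  define \<sigma> where "\<sigma> = (\<lambda>i. if i \<in> A then f i else if i \<in> B then g i else if i \<in> C then h i else i)"
  have sA: "bij_betw \<sigma> A A'" using f by (rule bij_betw_cong[THEN iffD1, rotated]) (simp add: \<sigma>_def)
  have sB: "bij_betw \<sigma> B B'" using g
    by (rule bij_betw_cong[THEN iffD1, rotated]) (use assms in \<open>auto simp: \<sigma>_def\<close>)
  have sC: "bij_betw \<sigma> C C'" using h
    by (rule bij_betw_cong[THEN iffD1, rotated]) (auto simp: \<sigma>_def C_def)
  have "bij_betw \<sigma> (A \<union> B \<union> C) (A' \<union> B' \<union> C')"
    by (intro bij_betw_combine sA sB sC) (use assms in \<open>auto simp: C'_def\<close>)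
  moreover have "A \<union> B \<union> C = V" "A' \<union> B' \<union> C' = V" using assms by (auto simp: C_def C'_def)
  ultimately have "bij_betw \<sigma> V V" by simp
  then have "\<sigma> permutes V"
    by (rule bij_imp_permutes) (use assms in \<open>auto simp: \<sigma>_def C_def\<close>)
  then show ?thesis using that sA sB by (auto simp: bij_betw_def)
qed

text \<open>The joint law of the images of two disjoint position sets depends only on their sizes,
  because composing with \<sigma> on the right preserves the uniform distribution.\<close>

lemma perm_prob_disjoint_pair:
  fixes V :: "'a set"
  assumes "finite V" "A \<subseteq> V" "B \<subseteq> V" "A \<inter> B = {}" "A' \<subseteq> V" "B' \<subseteq> V" "A' \<inter> B' = {}"
    and "card A = card A'" "card B = card B'"
  shows "perm_prob V (\<lambda>\<pi>. P (\<pi> ` A) (\<pi> ` B)) = perm_prob V (\<lambda>\<pi>. P (\<pi> ` A') (\<pi> ` B'))"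
proof -
  obtain \<sigma> where \<sigma>: "\<sigma> permutes V" "\<sigma> ` A = A'" "\<sigma> ` B = B'"
    using permutes_map_disjoint_pair[OF assms] by blast
  have "(\<pi> \<circ> \<sigma>) ` A = \<pi> ` A'" "(\<pi> \<circ> \<sigma>) ` B = \<pi> ` B'" for \<pi> :: "'a \<Rightarrow> 'a"
    using \<sigma>(2,3) by (metis image_comp)+
  then show ?thesis
    using perm_avg_compose_right[OF \<sigma>(1), of "\<lambda>\<pi>. of_bool (P (\<pi> ` A) (\<pi> ` B))"]
    by (simp del: comp_apply)
qed

text \<open>Here \<sigma> permutes only the positions outside \<open>C\<close> and
  \<open>C'\<close>, so the first two images are kept and only the third position set moves.\<close>

lemma perm_prob_disjoint_triple:
  fixes V :: "'a set"
  assumes "finite V" "C \<subseteq> V" "C' \<subseteq> V" "A \<subseteq> V - (C \<union> C')" "A' \<subseteq> V - (C \<union> C')" "card A = card A'"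
  shows "perm_prob V (\<lambda>\<pi>. P (\<pi> ` C) (\<pi> ` C') (\<pi> ` A)) = perm_prob V (\<lambda>\<pi>. P (\<pi> ` C) (\<pi> ` C') (\<pi> ` A'))"
proof -
  obtain \<sigma> where \<sigma>: "\<sigma> permutes (V - (C \<union> C'))" "\<sigma> ` A = A'"
    using permutes_map_disjoint_pair[of "V - (C \<union> C')" A "{}" A' "{}"] assms by auto
  have "\<sigma> i = i" if "i \<in> C \<union> C'" for i using permutes_not_in[OF \<sigma>(1)] that by simp
  then have "(\<pi> \<circ> \<sigma>) ` C = \<pi> ` C" "(\<pi> \<circ> \<sigma>) ` C' = \<pi> ` C'" "(\<pi> \<circ> \<sigma>) ` A = \<pi> ` A'" for \<pi> :: "'a \<Rightarrow> 'a"
    using \<sigma>(2) by (auto simp: image_def)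
  then show ?thesis
    using perm_avg_compose_right[OF permutes_subset[OF \<sigma>(1)], of V "\<lambda>\<pi>. of_bool (P (\<pi> ` C) (\<pi> ` C') (\<pi> ` A))"]
    by (simp del: comp_apply)
qed

lemma perm_prob_image_cong:
  assumes "finite V" "A \<subseteq> V" "A' \<subseteq> V" "card A = card A'"
  shows "perm_prob V (\<lambda>\<pi>. P (\<pi> ` A)) = perm_prob V (\<lambda>\<pi>. P (\<pi> ` A'))"
  using perm_prob_disjoint_pair[of V A "{}" A' "{}" "\<lambda>X Y. P X"] assms by simp

lemma perm_prob_image:
  assumes "finite V" "W \<subseteq> V"
  shows "perm_prob V (\<lambda>\<pi>. Q (\<pi> ` W)) * (card V choose card W)
           = card {S. S \<subseteq> V \<and> card S = card W \<and> Q S}"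
proof -
  let ?K = "{S. S \<subseteq> V \<and> card S = card W}"
  have finK: "finite ?K" using assms(1) by (auto intro: finite_subset[of _ "Pow V"])
  have "perm_prob V (\<lambda>\<pi>. Q (\<pi> ` W)) * (card V choose card W)
          = (\<Sum>S\<in>?K. perm_prob V (\<lambda>\<pi>. Q (\<pi> ` W)))"
    using n_subsets[OF assms(1), of "card W"] by simp
  also have "\<dots> = (\<Sum>S\<in>?K. perm_prob V (\<lambda>\<pi>. Q (\<pi> ` S)))"
    using assms by (intro sum.cong refl perm_prob_image_cong) auto
  also have "\<dots> = perm_avg V (\<lambda>\<pi>. \<Sum>S\<in>?K. of_bool (Q (\<pi> ` S)))"
    by (simp add: perm_avg_sum)
  also have "\<dots> = perm_avg V (\<lambda>\<pi>. \<Sum>S\<in>?K. of_bool (Q S))"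
  proof (rule perm_avg_cong)
    fix \<pi> assume \<pi>: "\<pi> permutes V"
    have inj: "inj \<pi>" "inj (inv \<pi>)" using permutes_inj \<pi> permutes_inv by blast+
    show "(\<Sum>S\<in>?K. of_bool (Q (\<pi> ` S))) = (\<Sum>S\<in>?K. of_bool (Q S) :: real)"
    proof (rule sum.reindex_bij_witness[where i="\<lambda>S. inv \<pi> ` S" and j="\<lambda>S. \<pi> ` S"])
      show "\<pi> ` S \<in> ?K" if "S \<in> ?K" for S
        using that permutes_in_image[OF \<pi>] card_image[OF inj_on_subset[OF inj(1)], of S] by auto
      show "inv \<pi> ` S \<in> ?K" if "S \<in> ?K" for S
        using that permutes_in_image[OF permutes_inv[OF \<pi>]] card_image[OF inj_on_subset[OF inj(2)], of S]
        by auto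
    qed (simp_all add: image_image permutes_inverses[OF \<pi>])
  qed
  also have "\<dots> = (\<Sum>S\<in>?K. of_bool (Q S))" by (simp add: perm_avg_const[OF assms(1)])
  also have "\<dots> = card {S. S \<subseteq> V \<and> card S = card W \<and> Q S}"
    using finK by (auto simp: sum_of_bool_eq intro!: arg_cong[where f=card])
  finally show ?thesis .
qed

lemma sum_image_permutes:
  assumes "\<pi> permutes V"
  shows "sum x (\<pi> ` W) = (\<Sum>i\<in>W. x (\<pi> i))"
  by (subst sum.reindex) (use permutes_inj[OF assms] in \<open>auto intro: inj_on_subset\<close>)

lemma sum_permutes:
  assumes "\<pi> permutes V"
  shows "(\<Sum>i\<in>V. x (\<pi> i)) = sum x V"
  using sum_image_permutes[OF assms, of x V] permutes_image[OF assms] by simp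

text \<open>Conditionally on the images of the positions in \<open>D\<close>, the image of a further position is
  uniform among the remaining elements.\<close>

lemma perm_avg_next_position:
  assumes "finite V" "D \<subseteq> V" "a \<in> V" "a \<notin> D"
  shows "real (card V - card D) * perm_avg V (\<lambda>\<pi>. g (\<Sum>i\<in>D. y (\<pi> i)) * h (\<pi> a))
       = perm_avg V (\<lambda>\<pi>. g (\<Sum>i\<in>D. y (\<pi> i)) * (sum h V - (\<Sum>i\<in>D. h (\<pi> i))))"
proof -
  have eq: "perm_avg V (\<lambda>\<pi>. g (\<Sum>i\<in>D. y (\<pi> i)) * h (\<pi> b))
          = perm_avg V (\<lambda>\<pi>. g (\<Sum>i\<in>D. y (\<pi> i)) * h (\<pi> a))" if "b \<in> V - D" for b
  proof -
    have "(\<Sum>i\<in>D. y ((\<pi> \<circ> transpose a b) i)) = (\<Sum>i\<in>D. y (\<pi> i))" for \<pi>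
      using that assms by (intro sum.cong) (auto simp: transpose_def)
    then show ?thesis
      using perm_avg_compose_right[of "transpose a b" V "\<lambda>\<pi>. g (\<Sum>i\<in>D. y (\<pi> i)) * h (\<pi> a)"]
        that assms permutes_swap_id[of a V b] by simp
  qed
  have "real (card V - card D) * perm_avg V (\<lambda>\<pi>. g (\<Sum>i\<in>D. y (\<pi> i)) * h (\<pi> a))
      = (\<Sum>b\<in>V - D. perm_avg V (\<lambda>\<pi>. g (\<Sum>i\<in>D. y (\<pi> i)) * h (\<pi> a)))"
    using finite_subset[OF assms(2,1)] assms(2) by (simp add: card_Diff_subset)
  also have "\<dots> = (\<Sum>b\<in>V - D. perm_avg V (\<lambda>\<pi>. g (\<Sum>i\<in>D. y (\<pi> i)) * h (\<pi> b)))"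
    by (intro sum.cong refl eq[symmetric])
  also have "\<dots> = perm_avg V (\<lambda>\<pi>. g (\<Sum>i\<in>D. y (\<pi> i)) * (\<Sum>b\<in>V - D. h (\<pi> b)))"
    by (simp add: perm_avg_sum sum_distrib_left)
  also have "\<dots> = perm_avg V (\<lambda>\<pi>. g (\<Sum>i\<in>D. y (\<pi> i)) * (sum h V - (\<Sum>i\<in>D. h (\<pi> i))))"
    by (intro perm_avg_cong) (simp add: sum_diff assms sum_permutes)
  finally show ?thesis .
qed

section \<open>Moments of sampling without replacement\<close>

lemma perm_avg_apply:
  assumes "finite V" "a \<in> V"
  shows "perm_avg V (\<lambda>\<pi>. h (\<pi> a)) = sum h V / card V"
proof -
  have "real (card V) \<noteq> 0" using assms by auto
  moreover have "real (card V) * perm_avg V (\<lambda>\<pi>. h (\<pi> a)) = sum h V"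
    using perm_avg_next_position[of V "{}" a "\<lambda>_. 1" "\<lambda>_. 0" h] assms
    by (simp add: perm_avg_const)
  ultimately show ?thesis by (metis nonzero_mult_div_cancel_left)
qed

context
  fixes V :: "'a set" and y :: "'a \<Rightarrow> real"
  assumes fin: "finite V" and sum0: "sum y V = 0"
begin

abbreviation (input) part_sum :: "'a set \<Rightarrow> ('a \<Rightarrow> 'a) \<Rightarrow> real" where
  "part_sum D \<pi> \<equiv> \<Sum>i\<in>D. y (\<pi> i)"

lemma perm_avg_part_sum: "D \<subseteq> V \<Longrightarrow> perm_avg V (part_sum D) = 0"
  by (simp add: perm_avg_sum perm_avg_apply[OF fin] sum0 subset_iff)

text \<open>As the values sum to zero, those not yet drawn sum to \<open>- part_sum D \<pi>\<close>,
  so this sum divided by their number is the conditional mean of the next one. Taking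
  \<open>g\<close> to be t or t^3 shows that the odd cross terms of the second and fourth moments
  are nonpositive.\<close>

lemma perm_avg_cross:
  assumes "D \<subseteq> V" "a \<in> V" "a \<notin> D"
  shows "perm_avg V (\<lambda>\<pi>. g (part_sum D \<pi>) * y (\<pi> a))
          = - perm_avg V (\<lambda>\<pi>. g (part_sum D \<pi>) * part_sum D \<pi>) / (card V - card D)"
proof -
  have "card D < card V" using assms fin by (metis psubset_card_mono psubsetI)
  moreover have "perm_avg V (\<lambda>\<pi>. g (part_sum D \<pi>) * - part_sum D \<pi>)
      = - perm_avg V (\<lambda>\<pi>. g (part_sum D \<pi>) * part_sum D \<pi>)"
    using perm_avg_cmult[of V "-1" "\<lambda>\<pi>. g (part_sum D \<pi>) * part_sum D \<pi>"] by simp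
  ultimately show ?thesis
    using perm_avg_next_position[OF fin assms, of g y y] by (simp add: sum0 field_simps of_nat_diff)
qed

lemma second_moment_insert:
  assumes "D \<subseteq> V" "a \<in> V" "a \<notin> D"
  shows "perm_avg V (\<lambda>\<pi>. (part_sum (insert a D) \<pi>)\<^sup>2)
       = perm_avg V (\<lambda>\<pi>. (part_sum D \<pi>)\<^sup>2) * (1 - 2 / (real (card V) - card D))
         + (\<Sum>i\<in>V. (y i)\<^sup>2) / card V"
proof -
  have "finite D" using assms fin finite_subset by blast
  then have "perm_avg V (\<lambda>\<pi>. (part_sum (insert a D) \<pi>)\<^sup>2)
      = perm_avg V (\<lambda>\<pi>. (part_sum D \<pi>)\<^sup>2 + 2 * (part_sum D \<pi> * y (\<pi> a)) + (y (\<pi> a))\<^sup>2)"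
    using assms by (simp add: power2_sum algebra_simps)
  also have "\<dots> = perm_avg V (\<lambda>\<pi>. (part_sum D \<pi>)\<^sup>2)
      + 2 * (- perm_avg V (\<lambda>\<pi>. (part_sum D \<pi>)\<^sup>2) / (real (card V) - card D))
      + (\<Sum>i\<in>V. (y i)\<^sup>2) / card V"
    using perm_avg_cross[OF assms, of "\<lambda>t. t"] perm_avg_apply[OF fin assms(2), of "\<lambda>i. (y i)\<^sup>2"]
      card_mono[OF fin assms(1)]
    by (simp add: perm_avg_add perm_avg_cmult power2_eq_square of_nat_diff)
  finally show ?thesis by (simp add: algebra_simps)
qed

lemma second_moment_le:
  assumes "D \<subseteq> V"
  shows "perm_avg V (\<lambda>\<pi>. (part_sum D \<pi>)\<^sup>2) \<le> card D * ((\<Sum>i\<in>V. (y i)\<^sup>2) / card V)"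
  using finite_subset[OF assms fin] assms
proof (induction D rule: finite_induct)
  case empty
  then show ?case by (simp add: perm_avg_const[OF fin])
next
  case (insert a D)
  have "card D < card V" using insert fin by (intro psubset_card_mono) auto
  moreover have "0 \<le> perm_avg V (\<lambda>\<pi>. (part_sum D \<pi>)\<^sup>2)"
    by (intro perm_avg_nonneg) simp
  ultimately have "perm_avg V (\<lambda>\<pi>. (part_sum D \<pi>)\<^sup>2) * (1 - 2 / (real (card V) - card D))
      \<le> perm_avg V (\<lambda>\<pi>. (part_sum D \<pi>)\<^sup>2)"
    by (intro mult_left_le) auto
  then show ?case
    using second_moment_insert[of D a] insert by (simp add: algebra_simps add_divide_distrib)
qed

lemma second_moment_ge:
  assumes "D \<subseteq> V" "100 * card D \<le> card V"
  shows "9 / 10 * (card D * ((\<Sum>i\<in>V. (y i)\<^sup>2) / card V)) \<le> perm_avg V (\<lambda>\<pi>. (part_sum D \<pi>)\<^sup>2)"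
  using finite_subset[OF assms(1) fin] assms
proof (induction D rule: finite_induct)
  case empty
  then show ?case by (simp add: perm_avg_const[OF fin])
next
  case (insert a D)
  define w where "w = (\<Sum>i\<in>V. (y i)\<^sup>2) / card V"
  define e where "e = perm_avg V (\<lambda>\<pi>. (part_sum D \<pi>)\<^sup>2)"
  have w: "w \<ge> 0" by (auto simp: w_def intro!: divide_nonneg_nonneg sum_nonneg)
  have e: "e \<le> card D * w" "9 / 10 * (card D * w) \<le> e" 
    using second_moment_le[of D] insert by (auto simp: e_def w_def)
  have c: "100 * real (card D) + 100 \<le> real (card V)" using insert by simp
  \<comment> \<open>The negative correlation costs at most a tenth of \<open>w\<close> in each step,
    because \<open>card D\<close> is at most a hundredth of \<open>card V\<close>.\<close>
  have "2 / (real (card V) - card D) * e \<le> 2 / (real (card V) - card D) * (card D * w)"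
    using e c by (intro mult_left_mono) auto
  also have "\<dots> = (2 * real (card D) / (real (card V) - card D)) * w" by simp
  also have "\<dots> \<le> 1 / 10 * w"
    using c w by (intro mult_right_mono) (auto simp: field_simps)
  finally have "9 / 10 * (card D * w) + 9 / 10 * w \<le> e - 2 / (real (card V) - card D) * e + w"
    using e(2) by linarith
  then have "9 / 10 * ((card D + 1) * w) \<le> e * (1 - 2 / (real (card V) - card D)) + w"
    by (simp add: algebra_simps add_divide_distrib)
  then show ?case
    using second_moment_insert[of D a] insert by (simp add: e_def w_def add.commute)
qed

text \<open>Positions are added one at a time. The cubic cross term is nonpositive by
  \<open>perm_avg_cross\<close>, and the mixed quadratic term is controlled by the second
  moment.\<close>

lemma fourth_moment_le:
  assumes "D \<subseteq> V" "2 * card D \<le> card V"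
  shows "perm_avg V (\<lambda>\<pi>. (part_sum D \<pi>) ^ 4)
       \<le> 8 * (card D * ((\<Sum>i\<in>V. (y i)\<^sup>2) / card V))\<^sup>2 + 3 * (card D * ((\<Sum>i\<in>V. (y i) ^ 4) / card V))"
  using finite_subset[OF assms(1) fin] assms
proof (induction D rule: finite_induct)
  case empty
  then show ?case by (simp add: perm_avg_const[OF fin])
next
  case (insert a D)
  define m where "m = real (card V)"
  define d where "d = real (card D)"
  define s2 where "s2 = (\<Sum>i\<in>V. (y i)\<^sup>2)"
  define s4 where "s4 = (\<Sum>i\<in>V. (y i) ^ 4)"
  have md: "2 * d + 2 \<le> m" "0 \<le> d" using insert by (auto simp: m_def d_def)
  have s2: "0 \<le> s2" by (auto simp: s2_def intro: sum_nonneg)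
  have aD: "D \<subseteq> V" "a \<in> V" "a \<notin> D" using insert by auto
  have cm: "real (card V - card D) = m - d"
    using card_mono[OF fin aD(1)] by (simp add: m_def d_def of_nat_diff)
  \<comment> \<open>The term 4 s t^3 has no useful sign and is absorbed by 4 s t^3 \<le> 2 s^2 t^2 +
    2 t^4. The term 4 s^3 t is kept because its average is nonpositive.\<close>
  have *: "(s + t) ^ 4 \<le> s ^ 4 + 4 * (s ^ 3 * t) + 8 * (s\<^sup>2 * t\<^sup>2) + 3 * t ^ 4" for s t :: real
  proof -
    have "0 \<le> 2 * t\<^sup>2 * (s - t)\<^sup>2" by simp
    then show ?thesis by (simp add: power2_eq_square power3_eq_cube power4_eq_xxxx algebra_simps)
  qed
  have "perm_avg V (\<lambda>\<pi>. (part_sum (insert a D) \<pi>) ^ 4)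
     \<le> perm_avg V (\<lambda>\<pi>. (part_sum D \<pi>) ^ 4 + 4 * ((part_sum D \<pi>) ^ 3 * y (\<pi> a))
         + 8 * ((part_sum D \<pi>)\<^sup>2 * (y (\<pi> a))\<^sup>2) + 3 * (y (\<pi> a)) ^ 4)"
    using * insert.hyps by (intro perm_avg_mono) (simp add: add.commute[of "y _"])
  also have "\<dots> = perm_avg V (\<lambda>\<pi>. (part_sum D \<pi>) ^ 4)
      + 4 * perm_avg V (\<lambda>\<pi>. (part_sum D \<pi>) ^ 3 * y (\<pi> a))
      + 8 * perm_avg V (\<lambda>\<pi>. (part_sum D \<pi>)\<^sup>2 * (y (\<pi> a))\<^sup>2)
      + 3 * perm_avg V (\<lambda>\<pi>. (y (\<pi> a)) ^ 4)"
    by (simp only: perm_avg_add perm_avg_cmult)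
  also have "perm_avg V (\<lambda>\<pi>. (y (\<pi> a)) ^ 4) = s4 / m"
    using perm_avg_apply[OF fin aD(2), of "\<lambda>i. (y i) ^ 4"] by (simp add: s4_def m_def)
  finally have main: "perm_avg V (\<lambda>\<pi>. (part_sum (insert a D) \<pi>) ^ 4)
     \<le> perm_avg V (\<lambda>\<pi>. (part_sum D \<pi>) ^ 4)
      + 4 * perm_avg V (\<lambda>\<pi>. (part_sum D \<pi>) ^ 3 * y (\<pi> a))
      + 8 * perm_avg V (\<lambda>\<pi>. (part_sum D \<pi>)\<^sup>2 * (y (\<pi> a))\<^sup>2) + 3 * (s4 / m)" .
  have "0 \<le> perm_avg V (\<lambda>\<pi>. (part_sum D \<pi>) ^ 4)" by (intro perm_avg_nonneg) simp
  then have cubic: "perm_avg V (\<lambda>\<pi>. (part_sum D \<pi>) ^ 3 * y (\<pi> a)) \<le> 0"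
    using perm_avg_cross[OF aD, of "\<lambda>t. t ^ 3"] cm md
    by (simp add: power4_eq_xxxx power3_eq_cube mult.assoc)
  have "(m - d) * perm_avg V (\<lambda>\<pi>. (part_sum D \<pi>)\<^sup>2 * (y (\<pi> a))\<^sup>2)
      = perm_avg V (\<lambda>\<pi>. (part_sum D \<pi>)\<^sup>2 * (s2 - (\<Sum>i\<in>D. (y (\<pi> i))\<^sup>2)))"
    using perm_avg_next_position[OF fin aD, of "\<lambda>t. t\<^sup>2" y "\<lambda>i. (y i)\<^sup>2"] cm by (simp add: s2_def)
  also have "\<dots> \<le> perm_avg V (\<lambda>\<pi>. s2 * (part_sum D \<pi>)\<^sup>2)"
  proof (intro perm_avg_mono)
    fix \<pi>
    have "0 \<le> (\<Sum>i\<in>D. (y (\<pi> i))\<^sup>2)" by (intro sum_nonneg) simp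
    then show "(part_sum D \<pi>)\<^sup>2 * (s2 - (\<Sum>i\<in>D. (y (\<pi> i))\<^sup>2)) \<le> s2 * (part_sum D \<pi>)\<^sup>2"
      by (simp add: algebra_simps)
  qed
  also have "\<dots> \<le> s2 * (d * (s2 / m))"
    unfolding perm_avg_cmult
    using second_moment_le[OF aD(1)] s2 by (intro mult_left_mono) (auto simp: s2_def d_def m_def)
  also have "\<dots> = m * (d * (s2 / m)\<^sup>2)" using md by (simp add: power2_eq_square)
  \<comment> \<open>At most half of \<open>V\<close> has been drawn, so m \<le> 2 (m - d).\<close>
  also have "\<dots> \<le> (m - d) * (2 * (d * (s2 / m)\<^sup>2))"
    using mult_right_mono[of m "(m - d) * 2" "d * (s2 / m)\<^sup>2"] md by (simp only: mult.assoc) simp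
  finally have quad: "perm_avg V (\<lambda>\<pi>. (part_sum D \<pi>)\<^sup>2 * (y (\<pi> a))\<^sup>2) \<le> 2 * (d * (s2 / m)\<^sup>2)"
    using md by simp
  have "perm_avg V (\<lambda>\<pi>. (part_sum D \<pi>) ^ 4) \<le> 8 * (d * (s2 / m))\<^sup>2 + 3 * (d * (s4 / m))"
    using insert by (simp add: d_def s2_def s4_def m_def)
  with main cubic quad have "perm_avg V (\<lambda>\<pi>. (part_sum (insert a D) \<pi>) ^ 4)
     \<le> 8 * (d * (s2 / m))\<^sup>2 + 3 * (d * (s4 / m)) + 16 * (d * (s2 / m)\<^sup>2) + 3 * (s4 / m)"
    by linarith
  \<comment> \<open>The increment 16 d is what 8 d^2 needs to become 8 (d + 1)^2 - 8.\<close>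
  also have "\<dots> = 8 * ((d + 1) * (s2 / m))\<^sup>2 + 3 * ((d + 1) * (s4 / m)) - 8 * (s2 / m)\<^sup>2"
    by (simp add: power2_eq_square algebra_simps add_divide_distrib)
  also have "\<dots> \<le> 8 * ((d + 1) * (s2 / m))\<^sup>2 + 3 * ((d + 1) * (s4 / m))" by simp
  finally show ?case
    using insert.hyps by (simp add: d_def s2_def s4_def m_def add.commute)
qed

end

section \<open>Probability bounds from the second and fourth moments\<close>

text \<open>A polynomial minorant of the indicator of the positive reals. For a variable of mean
  zero its linear term averages out, leaving second moment minus fourth moment.\<close>

lemma indicator_pos_ge_quartic: "z / 2 + z\<^sup>2 - z ^ 4 \<le> (of_bool (z > 0) :: real)"
proof (cases "z > 0")
  case True
  have "z ^ 4 - z\<^sup>2 - z / 2 + 1 = (z\<^sup>2 - 3/4)\<^sup>2 + (z - 1/2)\<^sup>2 / 2 + 5/16"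
    by (simp add: power2_eq_square power4_eq_xxxx field_simps)
  moreover have "0 \<le> (z\<^sup>2 - 3/4)\<^sup>2 + (z - 1/2)\<^sup>2 / 2" by simp
  ultimately have "z / 2 + z\<^sup>2 - z ^ 4 \<le> 1" by linarith
  then show ?thesis using True by simp
next
  case False
  \<comment> \<open>With w = -z the claim is w (w^3 - w + 1/2) \<ge> 0. The cubic has its minimum on
    w \<ge> 0 at 1/sqrt 3, approximated here by 3/5.\<close>
  have "0 \<le> (- z) * ((- z - 3/5)\<^sup>2 * (- z + 6/5) + 2/25 * (- z) + 17/250)"
    using False by (intro mult_nonneg_nonneg add_nonneg_nonneg) auto
  also have "\<dots> = - (z / 2 + z\<^sup>2 - z ^ 4)"
    by (simp add: power2_eq_square power4_eq_xxxx field_simps)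
  finally show ?thesis using False by simp
qed

lemma perm_prob_pos_ge:
  assumes "perm_avg V Z = 0" "l > 0"
  shows "perm_avg V (\<lambda>\<pi>. (Z \<pi>)\<^sup>2) / l\<^sup>2 - perm_avg V (\<lambda>\<pi>. (Z \<pi>) ^ 4) / l ^ 4
           \<le> perm_prob V (\<lambda>\<pi>. Z \<pi> > 0)"
proof -
  have "perm_avg V (\<lambda>\<pi>. 1 / (2 * l) * Z \<pi> + 1 / l\<^sup>2 * (Z \<pi>)\<^sup>2 - 1 / l ^ 4 * (Z \<pi>) ^ 4)
          \<le> perm_prob V (\<lambda>\<pi>. Z \<pi> > 0)"
  proof (intro perm_avg_mono)
    fix \<pi>
    show "1 / (2 * l) * Z \<pi> + 1 / l\<^sup>2 * (Z \<pi>)\<^sup>2 - 1 / l ^ 4 * (Z \<pi>) ^ 4 \<le> of_bool (Z \<pi> > 0)"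
      using indicator_pos_ge_quartic[of "Z \<pi> / l"] assms(2)
      by (simp add: power_divide zero_less_divide_iff)
  qed
  then show ?thesis
    by (simp only: perm_avg_diff perm_avg_add perm_avg_cmult assms(1)) simp
qed

lemma perm_prob_part_sum_pos:
  assumes "finite V" "sum y V = 0" "D \<subseteq> V" "100 * card D \<le> card V"
    and "\<And>i. i \<in> V \<Longrightarrow> \<bar>y i\<bar> \<le> c"
    and v: "v = card D * ((\<Sum>i\<in>V. (y i)\<^sup>2) / card V)"
  shows "v / (40 * v + 16 * c\<^sup>2) \<le> perm_prob V (\<lambda>\<pi>. (\<Sum>i\<in>D. y (\<pi> i)) > 0)"
proof (cases "v = 0")
  case True
  then show ?thesis by (simp add: perm_avg_nonneg)
next
  case False
  have "v \<ge> 0" unfolding v by (auto intro!: mult_nonneg_nonneg divide_nonneg_nonneg sum_nonneg)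
  with False have v0: "v > 0" by simp
  \<comment> \<open>The squared scale at which the minorant is applied. It makes the fourth moment
    at most 2/5 \<open>v * L\<close>, against a second moment of at least 9/10 \<open>v\<close>. The
    difference leaves \<open>v / (2 * L)\<close>.\<close>
  define L where "L = 20 * v + 8 * c\<^sup>2"
  have L: "L > 0" using v0 by (simp add: L_def add_pos_nonneg)
  define Z where "Z = (\<lambda>\<pi>. \<Sum>i\<in>D. y (\<pi> i))"
  have "(\<Sum>i\<in>V. (y i) ^ 4) \<le> c\<^sup>2 * (\<Sum>i\<in>V. (y i)\<^sup>2)"
    unfolding sum_distrib_left
  proof (rule sum_mono)
    fix i assume "i \<in> V"
    then have "(y i)\<^sup>2 \<le> c\<^sup>2" using assms(5) abs_le_square_iff[of "y i" c] by force
    then have "(y i)\<^sup>2 * (y i)\<^sup>2 \<le> c\<^sup>2 * (y i)\<^sup>2" by (intro mult_right_mono) auto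
    then show "(y i) ^ 4 \<le> c\<^sup>2 * (y i)\<^sup>2" by (simp add: power2_eq_square power4_eq_xxxx mult.assoc)
  qed
  then have "card D * ((\<Sum>i\<in>V. (y i) ^ 4) / card V) \<le> card D * (c\<^sup>2 * (\<Sum>i\<in>V. (y i)\<^sup>2) / card V)"
    by (intro mult_left_mono divide_right_mono) auto
  also have "\<dots> = c\<^sup>2 * v" by (simp add: v)
  finally have s4: "card D * ((\<Sum>i\<in>V. (y i) ^ 4) / card V) \<le> c\<^sup>2 * v" .
  have "perm_avg V (\<lambda>\<pi>. (Z \<pi>) ^ 4) \<le> 8 * v\<^sup>2 + 3 * (c\<^sup>2 * v)"
    using fourth_moment_le[OF assms(1-3)] assms(4) s4 unfolding Z_def v by linarith
  also have "\<dots> = 2 / 5 * (v * L) - c\<^sup>2 * v / 5"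
    by (simp add: L_def power2_eq_square field_simps)
  also have "\<dots> \<le> 2 / 5 * (v * L)" using v0 by simp
  finally have m4: "perm_avg V (\<lambda>\<pi>. (Z \<pi>) ^ 4) / L\<^sup>2 \<le> 2 / 5 * (v / L)"
    using L by (simp add: field_simps power2_eq_square)
  have m2: "9 / 10 * (v / L) \<le> perm_avg V (\<lambda>\<pi>. (Z \<pi>)\<^sup>2) / L"
    using divide_right_mono[OF second_moment_ge[OF assms(1-4)], of L] L by (simp add: v Z_def)
  have "perm_avg V (\<lambda>\<pi>. (Z \<pi>)\<^sup>2) / (sqrt L)\<^sup>2 - perm_avg V (\<lambda>\<pi>. (Z \<pi>) ^ 4) / (sqrt L) ^ 4
          \<le> perm_prob V (\<lambda>\<pi>. Z \<pi> > 0)"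
    using perm_avg_part_sum[OF assms(1-3)] L by (intro perm_prob_pos_ge) (auto simp: Z_def)
  moreover have "(sqrt L)\<^sup>2 = L" "(sqrt L) ^ 4 = L\<^sup>2"
    using L power_mult[of "sqrt L" 2 2] by simp_all
  ultimately have "1 / 2 * (v / L) \<le> perm_prob V (\<lambda>\<pi>. Z \<pi> > 0)" using m2 m4 by simp
  moreover have "1 / 2 * (v / L) = v / (40 * v + 16 * c\<^sup>2)" by (simp add: L_def)
  ultimately show ?thesis by (simp only: Z_def)
qed

lemma perm_prob_chebyshev:
  assumes "t > 0"
  shows "perm_prob V (\<lambda>\<pi>. Z \<pi> < - t) \<le> perm_avg V (\<lambda>\<pi>. (Z \<pi>)\<^sup>2) / t\<^sup>2"
proof -
  have "perm_prob V (\<lambda>\<pi>. Z \<pi> < - t) \<le> perm_avg V (\<lambda>\<pi>. 1 / t\<^sup>2 * (Z \<pi>)\<^sup>2)"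
  proof (intro perm_avg_mono)
    fix \<pi>
    have "t\<^sup>2 \<le> (Z \<pi>)\<^sup>2" if "Z \<pi> < - t"
      using that assms abs_le_square_iff[of t "Z \<pi>"] by simp
    then show "of_bool (Z \<pi> < - t) \<le> 1 / t\<^sup>2 * (Z \<pi>)\<^sup>2"
      using assms by (auto simp: of_bool_def field_simps)
  qed
  then show ?thesis by (simp only: perm_avg_cmult) simp
qed

text \<open>Both bounds share the same \<open>v\<close>: the first is strong when \<open>v\<close>
  is large compared with \<open>b\<^sup>2\<close>, the second (Chebyshev) when it is small. Centring
  at the nonnegative mean at most doubles the bound on the values, whence 64 = 16 * 2^2.\<close>

lemma perm_prob_image_pos_centred:
  assumes "finite V" "V \<noteq> {}" "sum x V \<ge> 0" "D \<subseteq> V" "100 * card D \<le> card V" "b > 0"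
    and "\<And>i. i \<in> V \<Longrightarrow> \<bar>x i\<bar> \<le> b"
  shows "\<exists>v\<ge>0. v / (40 * v + 64 * b\<^sup>2) \<le> perm_prob V (\<lambda>\<pi>. sum x (\<pi> ` D) \<ge> 0) \<and>
    (\<forall>t>0. perm_prob V (\<lambda>\<pi>. sum x (\<pi> ` D) < card D * (sum x V / card V) - t) \<le> v / t\<^sup>2)"
proof -
  define a where "a = sum x V / card V"
  define y where "y = (\<lambda>i. x i - a)"
  define v where "v = card D * ((\<Sum>i\<in>V. (y i)\<^sup>2) / card V)"
  have a0: "a \<ge> 0" using assms(3) by (simp add: a_def)
  have cV: "real (card V) > 0" using assms(1,2) by (simp add: card_gt_0_iff)
  have sy: "sum y V = 0" using cV by (simp add: y_def sum_subtractf a_def)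
  have "sum x V \<le> card V * b" using assms(7) by (intro sum_bounded_above) force
  then have "a \<le> b" using cV by (simp add: a_def field_simps)
  then have yb: "\<bar>y i\<bar> \<le> 2 * b" if "i \<in> V" for i
    using assms(7)[OF that] a0 by (simp add: y_def)
  have eq: "sum x (\<pi> ` D) = (\<Sum>i\<in>D. y (\<pi> i)) + card D * a" if "\<pi> permutes V" for \<pi>
    by (simp add: sum_image_permutes[OF that] y_def sum_subtractf)
  have "v \<ge> 0" unfolding v_def by (auto intro!: mult_nonneg_nonneg divide_nonneg_nonneg sum_nonneg)
  moreover have "v / (40 * v + 64 * b\<^sup>2) \<le> perm_prob V (\<lambda>\<pi>. sum x (\<pi> ` D) \<ge> 0)"
  proof -
    have "v / (40 * v + 64 * b\<^sup>2) \<le> perm_prob V (\<lambda>\<pi>. (\<Sum>i\<in>D. y (\<pi> i)) > 0)"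
      using perm_prob_part_sum_pos[OF assms(1) sy assms(4,5) yb v_def] by (simp add: power2_eq_square)
    also have "\<dots> \<le> perm_prob V (\<lambda>\<pi>. sum x (\<pi> ` D) \<ge> 0)"
      using a0 by (intro perm_prob_mono) (simp add: eq)
    finally show ?thesis .
  qed
  moreover have "perm_prob V (\<lambda>\<pi>. sum x (\<pi> ` D) < card D * (sum x V / card V) - t) \<le> v / t\<^sup>2"
    if "t > 0" for t
  proof -
    have "perm_prob V (\<lambda>\<pi>. sum x (\<pi> ` D) < card D * (sum x V / card V) - t)
        \<le> perm_prob V (\<lambda>\<pi>. (\<Sum>i\<in>D. y (\<pi> i)) < - t)"
      by (intro perm_prob_mono) (simp add: eq flip: a_def)
    also have "\<dots> \<le> perm_avg V (\<lambda>\<pi>. (\<Sum>i\<in>D. y (\<pi> i))\<^sup>2) / t\<^sup>2"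
      by (rule perm_prob_chebyshev[OF that])
    also have "\<dots> \<le> v / t\<^sup>2"
      unfolding v_def by (intro divide_right_mono second_moment_le assms(1,4) sy) simp
    finally show ?thesis .
  qed
  ultimately show ?thesis by blast
qed

section \<open>The dichotomy\<close>

lemma choose_add_le: "(m + l) choose Suc k \<le> (m choose Suc k) + l * ((m + l - 1) choose k)"
proof (induction l)
  case (Suc l)
  have "(m + l - 1) choose k \<le> (m + l) choose k" by (rule binomial_right_mono) simp
  then have "l * ((m + l - 1) choose k) \<le> l * ((m + l) choose k)" by simp
  with Suc show ?case by (auto intro: le_trans)
qed simp

text \<open>A given element lies in a fraction k/(m + l) of the k-sets, so at most a fraction k l/(m
  + l) \<le> 1/2 of them meets the \<open>l\<close> discarded elements.\<close>

lemma choose_le_twice: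
  assumes "2 * k * l \<le> m + l"
  shows "(m + l) choose k \<le> 2 * (m choose k)"
proof (cases k)
  case (Suc j)
  show ?thesis
  proof (cases "m + l = 0")
    case False
    have "2 * (m + l) * ((m + l) choose k) \<le> 2 * (m + l) * (m choose k) + 2 * l * ((m + l) * ((m + l - 1) choose j))"
      using mult_le_mono2[OF choose_add_le[of m l j], of "2 * (m + l)"] Suc by (simp add: algebra_simps)
    also have "(m + l) * ((m + l - 1) choose j) = k * ((m + l) choose k)"
      using binomial_absorption[of j "m + l"] Suc by simp
    also have "2 * l * (k * ((m + l) choose k)) \<le> (m + l) * ((m + l) choose k)"
      using mult_le_mono1[OF assms, of "(m + l) choose k"] by (simp add: mult_ac)
    finally have "(m + l) * ((m + l) choose k) \<le> (m + l) * (2 * (m choose k))" 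
      by (simp add: algebra_simps)
    then show ?thesis using False by (simp only: mult_le_cancel1)
  qed (simp add: Suc)
qed simp

lemma ex_smallest_subset:
  fixes x :: "'a \<Rightarrow> real"
  assumes "finite V" "l \<le> card V"
  shows "\<exists>N\<subseteq>V. card N = l \<and> (\<forall>i\<in>N. \<forall>j\<in>V - N. x i \<le> x j)"
  using assms(2)
proof (induction l)
  case 0
  then show ?case by (intro exI[of _ "{}"]) simp
next
  case (Suc l)
  then obtain N where N: "N \<subseteq> V" "card N = l" "\<forall>i\<in>N. \<forall>j\<in>V - N. x i \<le> x j" by auto
  have "V - N \<noteq> {}" using N Suc.prems by (metis Diff_eq_empty_iff card_mono assms(1) finite_subset not_less_eq_eq)
  then obtain a where a: "a \<in> V - N" "\<forall>j\<in>V - N. x a \<le> x j"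
    using ex_min_if_finite[of "x ` (V - N)"] assms(1) by (metis arg_min_if_finite finite_Diff arg_min_least)
  show ?case
    using N a assms(1) finite_subset[OF N(1)] by (intro exI[of _ "insert a N"]) auto
qed

lemma many_nonneg_or_popular_max:
  fixes x :: "'a \<Rightarrow> real"
  assumes fin: "finite V" and k: "k > 0" and big: "1000 * k \<le> card V" and sum0: "sum x V \<ge> 0"
    and z: "z \<in> V" "\<And>i. i \<in> V \<Longrightarrow> x i \<le> x z"
  shows "(card V choose k) \<le> 5000 * card {S. S \<subseteq> V \<and> card S = k \<and> sum x S \<ge> 0} \<or>
    ((card V - 1) choose (k - 1)) \<le> 800 * card {T. T \<subseteq> V - {z} \<and> card T = k - 1 \<and> x z + sum x T \<ge> 0}"
    (is "_ \<le> 5000 * card ?S \<or> _ \<le> 800 * card ?T")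
proof -
  define n where "n = card V"
  \<comment> \<open>The largest number of elements that \<open>choose_le_twice\<close> allows to
    discard while keeping half of the k-sets.\<close>
  define l where "l = n div (2 * k)"
  have l1: "2 * k * l \<le> n" by (simp add: l_def)
  have "n = 2 * k * l + n mod (2 * k)" by (simp add: l_def)
  moreover have "n mod (2 * k) < 2 * k" using k by simp
  ultimately have l2: "n < 2 * k * l + 2 * k" by linarith
  have l0: "l > 0" using l2 big by (cases l) (auto simp: n_def)
  have "2 * l \<le> 2 * k * l" using k by (cases k) simp_all
  then have ln: "2 * l \<le> n" using l1 by (rule le_trans)
  have "l \<le> card (V - {z})" using z(1) ln l0 by (simp add: n_def)
  \<comment> \<open>The discarded elements are taken from \<open>V - {z}\<close>, so that
    \<open>z\<close> survives even when there are ties.\<close>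
  then obtain N where N: "N \<subseteq> V - {z}" "card N = l" "\<forall>i\<in>N. \<forall>j\<in>V - {z} - N. x i \<le> x j"
    using ex_smallest_subset[of "V - {z}" l x] fin by blast
  define Y where "Y = V - N"
  define m where "m = card Y"
  have fN: "finite N" using N fin finite_subset by blast
  have finY: "finite Y" using fin by (simp add: Y_def)
  have NV: "N \<subseteq> V" using N by blast
  have m: "m + l = n"
    using N(2) card_Diff_subset[OF fN NV] card_mono[OF fin NV] by (simp add: m_def Y_def n_def)
  have zY: "z \<in> Y" using z N by (auto simp: Y_def)
  have Yne: "Y \<noteq> {}" using zY by blast
  have NY: "x i \<le> x j" if "i \<in> N" "j \<in> Y" for i j
    using that N z by (cases "j = z") (auto simp: Y_def)
  \<comment> \<open>The threshold separating \<open>N\<close> from \<open>Y\<close>: values are at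
    most \<open>- Q\<close> on \<open>N\<close> and at least \<open>- Q\<close> on \<open>Y\<close>.
    As the total is nonnegative, \<open>Y\<close> has sum at least \<open>l * Q\<close>.\<close>
  define Q where "Q = - Max (x ` N)"
  have Nne: "N \<noteq> {}" using N l0 by auto
  have QN: "x i \<le> - Q" if "i \<in> N" for i using that fN by (simp add: Q_def)
  have QY: "- Q \<le> x j" if "j \<in> Y" for j
    using NY[OF _ that] Nne fN by (auto simp: Q_def)
  have "sum x N \<le> l * (- Q)" using sum_bounded_above[of N x "- Q"] QN N by simp
  moreover have "sum x V = sum x N + sum x Y"
    using N fin unfolding Y_def by (metis Diff_subset add.commute order_trans sum.subset_diff)
  ultimately have sY: "l * Q \<le> sum x Y" using sum0 by linarith
  have choose_half: "n choose j \<le> 2 * (m choose j)" if "j \<le> k" for j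
  proof -
    have "2 * j * l \<le> 2 * k * l" using that by (intro mult_le_mono) auto
    also have "\<dots> \<le> m + l" using l1 m by simp
    finally show ?thesis using choose_le_twice[of j l m] m by simp
  qed
  have m500: "500 * k \<le> m" using m ln big by (simp add: n_def)
  have SY: "card {S. S \<subseteq> Y \<and> card S = k \<and> sum x S \<ge> 0} \<le> card ?S"
    using fin by (intro card_mono) (auto simp: Y_def)
  have ex: "\<exists>D\<subseteq>Y. card D = j" if "j \<le> k" for j
    using obtain_subset_with_card_n[of j Y] that m500 k by (auto simp: m_def)
  show ?thesis
  proof (cases "Q \<le> 0")
    case True
    then have "x i \<ge> 0" if "i \<in> Y" for i using QY[OF that] by linarith
    then have "{S. S \<subseteq> Y \<and> card S = k \<and> sum x S \<ge> 0} = {S. S \<subseteq> Y \<and> card S = k}"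
      by (auto intro: sum_nonneg)
    then have "m choose k \<le> card ?S" using SY n_subsets[OF finY, of k] by (simp add: m_def)
    then show ?thesis using choose_half[of k] by (simp add: n_def)
  next
    case False
    then have Q: "Q > 0" by simp
    have sY0: "sum x Y \<ge> 0" using sY Q by (smt (verit) mult_nonneg_nonneg of_nat_0_le_iff)
    show ?thesis
    proof (cases "x z \<le> Q")
      case True
      have bd: "\<bar>x i\<bar> \<le> Q" if "i \<in> Y" for i
        using QY[OF that] z(2)[of i] that True by (auto simp: Y_def)
      obtain D where D: "D \<subseteq> Y" "card D = k" using ex by auto
      define P where "P = perm_prob Y (\<lambda>\<pi>. sum x (\<pi> ` D) \<ge> 0)"
      have "100 * card D \<le> card Y" using D m500 by (simp add: m_def)
      then obtain v where v: "v \<ge> 0" "v / (40 * v + 64 * Q\<^sup>2) \<le> perm_prob Y (\<lambda>\<pi>. sum x (\<pi> ` D) \<ge> 0)"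
        "\<And>t. t > 0 \<Longrightarrow> perm_prob Y (\<lambda>\<pi>. sum x (\<pi> ` D) < card D * (sum x Y / card Y) - t) \<le> v / t\<^sup>2"
        using perm_prob_image_pos_centred[OF finY Yne sY0 D(1) _ Q bd] by blast
      \<comment> \<open>The mean is at least k l Q/m, and m \<le> n < 2 k l + 2 k \<le> 4 k
        l.\<close>
      have mean: "Q / 4 \<le> k * (sum x Y / m)"
      proof -
        have "m \<le> 4 * (k * l)" using l2 m big k l0 by (simp add: n_def)
        then have "real m \<le> 4 * (real k * real l)" by (metis of_nat_le_iff of_nat_mult of_nat_numeral)
        then have "real m * Q \<le> 4 * (real k * real l) * Q" using Q by (intro mult_right_mono) auto
        also have "\<dots> = 4 * (k * (l * Q))" by simp
        also have "\<dots> \<le> 4 * (k * sum x Y)" using sY by (intro mult_left_mono) auto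
        finally show ?thesis using m500 k by (simp add: field_simps)
      qed
      have P1: "1 - P \<le> v / (Q / 4)\<^sup>2"
      proof -
        have "1 - P = perm_prob Y (\<lambda>\<pi>. \<not> sum x (\<pi> ` D) \<ge> 0)"
          by (simp only: perm_prob_not[OF finY] P_def)
        also have "\<dots> \<le> perm_prob Y (\<lambda>\<pi>. sum x (\<pi> ` D) < card D * (sum x Y / card Y) - Q / 4)"
          using mean unfolding m_def D(2) by (intro perm_prob_mono) linarith
        also have "\<dots> \<le> v / (Q / 4)\<^sup>2" using v(3) Q by simp
        finally show ?thesis .
      qed
      \<comment> \<open>If v \<le> Q^2/32, Chebyshev gives 1/2. Otherwise 64 Q^2 < 2048 v, and the
        moment bound gives at least 1/2088.\<close>
      have "1 / 2500 \<le> P"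
      proof (cases "v \<le> Q\<^sup>2 / 32")
        case True
        then have "v / (Q / 4)\<^sup>2 \<le> 1 / 2" using Q by (simp add: field_simps power2_eq_square)
        then show ?thesis using P1 by simp
      next
        case False
        then have "40 * v + 64 * Q\<^sup>2 \<le> 2500 * v" "v > 0" using v(1) Q
          by (auto intro: le_less_trans[of 0 "Q\<^sup>2 / 32"])
        then have "1 / 2500 \<le> v / (40 * v + 64 * Q\<^sup>2)" using Q
          by (simp add: field_simps add_pos_nonneg)
        then show ?thesis using v(2) unfolding P_def by linarith
      qed
      then have "1 / 2500 * (m choose k) \<le> P * (m choose k)" by (intro mult_right_mono) auto
      also have "\<dots> = card {S. S \<subseteq> Y \<and> card S = k \<and> sum x S \<ge> 0}"
        using perm_prob_image[OF finY D(1), of "\<lambda>S. sum x S \<ge> 0"] D by (simp add: P_def m_def)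
      also have "\<dots> \<le> card ?S" using SY by simp
      finally have "m choose k \<le> 2500 * card ?S" by simp
      then show ?thesis using choose_half[of k] by (simp add: n_def)
    next
      case False
      define b where "b = x z"
      \<comment> \<open>Now \<open>x z\<close> dominates all absolute values on \<open>Y\<close>.
        Adding it to a (k-1)-set helps by a full \<open>b\<close>, so failure means a deviation of
        more than \<open>b\<close> below a nonnegative mean.\<close>
      have b: "b > 0" using Q False by (simp add: b_def)
      have bd: "\<bar>x i\<bar> \<le> b" if "i \<in> Y" for i
        using QY[OF that] z(2)[of i] that False by (auto simp: Y_def b_def)
      obtain D where D: "D \<subseteq> Y" "card D = k - 1" using ex[of "k - 1"] by auto
      define P where "P = perm_prob Y (\<lambda>\<pi>. b + sum x (\<pi> ` D) \<ge> 0)"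
      have "100 * card D \<le> card Y" using D m500 by (simp add: m_def)
      then obtain v where v: "v \<ge> 0" "v / (40 * v + 64 * b\<^sup>2) \<le> perm_prob Y (\<lambda>\<pi>. sum x (\<pi> ` D) \<ge> 0)"
        "\<And>t. t > 0 \<Longrightarrow> perm_prob Y (\<lambda>\<pi>. sum x (\<pi> ` D) < card D * (sum x Y / card Y) - t) \<le> v / t\<^sup>2"
        using perm_prob_image_pos_centred[OF finY Yne sY0 D(1) _ b bd] by blast
      have P1: "1 - P \<le> v / b\<^sup>2"
      proof -
        have "1 - P = perm_prob Y (\<lambda>\<pi>. \<not> b + sum x (\<pi> ` D) \<ge> 0)"
          by (simp only: perm_prob_not[OF finY] P_def)
        also have "\<dots> \<le> perm_prob Y (\<lambda>\<pi>. sum x (\<pi> ` D) < card D * (sum x Y / card Y) - b)"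
        proof (intro perm_prob_mono)
          fix \<pi> assume "\<not> b + sum x (\<pi> ` D) \<ge> 0"
          moreover have "0 \<le> card D * (sum x Y / card Y)" using sY0 by simp
          ultimately show "sum x (\<pi> ` D) < card D * (sum x Y / card Y) - b" by linarith
        qed
        also have "\<dots> \<le> v / b\<^sup>2" using v(3) b by simp
        finally show ?thesis .
      qed
      have P2: "v / (40 * v + 64 * b\<^sup>2) \<le> P"
        using v(2) perm_prob_mono[of Y "\<lambda>\<pi>. sum x (\<pi> ` D) \<ge> 0" "\<lambda>\<pi>. b + sum x (\<pi> ` D) \<ge> 0"] b
        by (simp add: P_def)
      have P: "1 / 200 \<le> P"
      proof (rule ccontr)
        assume "\<not> 1 / 200 \<le> P"
        then have P': "P < 1 / 200" by simp
        then have "199 / 200 < v / b\<^sup>2" using P1 by linarith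
        then have "199 / 200 * b\<^sup>2 < v" using b by (simp add: field_simps)
        moreover have "b\<^sup>2 > 0" using b by simp
        ultimately have "0 < 40 * v + 64 * b\<^sup>2" "40 * v + 64 * b\<^sup>2 \<le> 200 * v" by linarith+
        then have "1 / 200 \<le> v / (40 * v + 64 * b\<^sup>2)" by (simp add: pos_le_divide_eq)
        then show False using P' P2 by linarith
      qed
      \<comment> \<open>The random set was drawn from all of \<open>Y\<close> and may contain
        \<open>z\<close>. A union bound over positions shows that discarding this event costs at
        most half of the 1/200.\<close>
      have "perm_prob Y (\<lambda>\<pi>. z \<in> \<pi> ` D) \<le> perm_avg Y (\<lambda>\<pi>. \<Sum>i\<in>D. of_bool (\<pi> i = z))"
      proof (intro perm_avg_mono)
        fix \<pi>
        have fD: "finite D" using D finY finite_subset by blast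
        show "of_bool (z \<in> \<pi> ` D) \<le> (\<Sum>i\<in>D. of_bool (\<pi> i = z) :: real)"
        proof (cases "z \<in> \<pi> ` D")
          case True
          then obtain i where i: "i \<in> D" "\<pi> i = z" by auto
          have "(of_bool (\<pi> i = z) :: real) \<le> (\<Sum>i\<in>D. of_bool (\<pi> i = z))"
            using i fD by (intro member_le_sum) auto
          then show ?thesis using i by simp
        qed (simp add: sum_nonneg)
      qed
      also have "\<dots> = (\<Sum>i\<in>D. (\<Sum>j\<in>Y. of_bool (j = z)) / real m)"
        unfolding perm_avg_sum m_def using D by (intro sum.cong refl perm_avg_apply finY) auto
      also have "\<dots> = (k - 1) / real m"
        using zY finY D by (simp add: of_bool_def)
      also have "\<dots> \<le> 1 / 400" using m500 k by (simp add: field_simps)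
      finally have hit: "perm_prob Y (\<lambda>\<pi>. z \<in> \<pi> ` D) \<le> 1 / 400" .
      have "P \<le> perm_avg Y (\<lambda>\<pi>. of_bool (z \<notin> \<pi> ` D \<and> b + sum x (\<pi> ` D) \<ge> 0) + of_bool (z \<in> \<pi> ` D))"
        unfolding P_def by (intro perm_avg_mono) (auto simp: of_bool_def)
      then have "1 / 400 \<le> perm_prob Y (\<lambda>\<pi>. z \<notin> \<pi> ` D \<and> b + sum x (\<pi> ` D) \<ge> 0)"
        using P hit by (simp add: perm_avg_add)
      then have "1 / 400 * (m choose (k - 1)) \<le> perm_prob Y (\<lambda>\<pi>. z \<notin> \<pi> ` D \<and> b + sum x (\<pi> ` D) \<ge> 0) * (m choose (k - 1))"
        by (intro mult_right_mono) auto
      also have "\<dots> = card {T. T \<subseteq> Y \<and> card T = k - 1 \<and> z \<notin> T \<and> b + sum x T \<ge> 0}"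
        using perm_prob_image[OF finY D(1), of "\<lambda>S. z \<notin> S \<and> b + sum x S \<ge> 0"] D by (simp add: m_def)
      also have "\<dots> \<le> card ?T"
        using fin by (intro of_nat_mono card_mono) (auto simp: Y_def b_def)
      finally have "m choose (k - 1) \<le> 400 * card ?T" by simp
      moreover have "(n - 1) choose (k - 1) \<le> n choose (k - 1)" by (rule binomial_right_mono) simp
      ultimately show ?thesis using choose_half[of "k - 1"] by (simp add: n_def)
    qed
  qed
qed

lemma finite_ex_maximizer:
  fixes x :: "'a \<Rightarrow> real"
  assumes "finite V" "V \<noteq> {}"
  obtains z where "z \<in> V" "\<And>i. i \<in> V \<Longrightarrow> x i \<le> x z"
proof -
  have "Max (x ` V) \<in> x ` V" using assms by (intro Max_in) auto
  then obtain z where "z \<in> V" "x z = Max (x ` V)" by auto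
  then show ?thesis using that[of z] assms(1) by simp
qed

text \<open>In the second case of the dichotomy, adding \<open>z\<close> injects the (k-1)-sets into
  nonnegative k-sets. The upper bound on \<open>card V\<close> limits the loss to a factor 1001, and
  1001 * 800 \<le> 10^6.\<close>

lemma nonneg_subsets_weak_bound:
  fixes x :: "'a \<Rightarrow> real"
  assumes fin: "finite V" and k: "k > 0" and big: "1000 * k \<le> card V" "card V \<le> 1001 * k"
    and sum0: "sum x V \<ge> 0"
  shows "(card V choose k) \<le> 10 ^ 6 * card {S. S \<subseteq> V \<and> card S = k \<and> sum x S \<ge> 0}"
    (is "_ \<le> _ * card ?S")
proof -
  have "V \<noteq> {}" using k big by auto
  then obtain z where z: "z \<in> V" "\<And>i. i \<in> V \<Longrightarrow> x i \<le> x z"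
    using finite_ex_maximizer[OF fin, of x] by blast
  let ?T = "{T. T \<subseteq> V - {z} \<and> card T = k - 1 \<and> x z + sum x T \<ge> 0}"
  have finT: "finite T" if "T \<subseteq> V - {z}" for T using that fin finite_subset by blast
  have TS: "card ?T \<le> card ?S"
  proof (rule card_inj_on_le[of "insert z"])
    show "inj_on (insert z) ?T"
      by (intro inj_onI) (metis (no_types, lifting) Diff_iff insert_ident mem_Collect_eq singletonI subsetD)
    have "insert z T \<in> ?S" if T: "T \<in> ?T" for T
    proof -
      have "z \<notin> T" "finite T" using T finT by auto
      then show ?thesis using T z(1) k by auto
    qed
    then show "insert z ` ?T \<subseteq> ?S" by blast
    show "finite ?S" using fin by (auto intro: finite_subset[of _ "Pow V"])
  qed
  consider "(card V choose k) \<le> 5000 * card ?S" | "((card V - 1) choose (k - 1)) \<le> 800 * card ?T"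
    using many_nonneg_or_popular_max[OF fin k big(1) sum0 z] by blast
  then show ?thesis
  proof cases
    case 2
    have "k * (card V choose k) = card V * ((card V - 1) choose (k - 1))"
      using binomial_absorption[of "k - 1" "card V"] k by simp
    also have "\<dots> \<le> (1001 * k) * (800 * card ?S)"
      using 2 TS big(2) by (intro mult_le_mono) auto
    finally have "k * (card V choose k) \<le> k * (800800 * card ?S)" by simp
    then show ?thesis using k by simp
  qed simp
qed

section \<open>Removing the maximum\<close>

text \<open>For independent uniform sets \<open>\<pi>A\<close> and \<open>\<pi>\<tau>A\<close> choose a third set disjoint from both: if the first
  satisfies \<open>F\<close> and the second does not, then \<open>F\<close> changes along one of the two disjoint pairs.\<close>

lemma perm_prob_disjoint_separate:
  fixes V :: "'a set"
  assumes fin: "finite V" and AB: "A \<subseteq> V" "B \<subseteq> V" "A \<inter> B = {}" "card A = card B"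
    and big: "3 * card A \<le> card V"
    and q: "q = perm_prob V (\<lambda>\<pi>. F (\<pi> ` A))"
  shows "q * (1 - q) / 2 \<le> perm_prob V (\<lambda>\<pi>. F (\<pi> ` A) \<and> \<not> F (\<pi> ` B))" (is "_ \<le> ?d")
proof -
  have *: "perm_prob V (\<lambda>\<pi>. F (\<pi> ` A) \<and> \<not> F ((\<pi> \<circ> \<tau>) ` A)) \<le> 2 * ?d" if \<tau>: "\<tau> permutes V" for \<tau>
  proof -
    have fA: "finite A" using AB fin finite_subset by blast
    have tA: "\<tau> ` A \<subseteq> V" using permutes_image[OF \<tau>] AB(1) by blast
    have ctA: "card (\<tau> ` A) = card A" using permutes_inj_on[OF \<tau>] by (simp add: card_image)
    have "card (A \<union> \<tau> ` A) \<le> 2 * card A" using card_Un_le[of A "\<tau> ` A"] ctA by simp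
    then have "card A \<le> card (V - (A \<union> \<tau> ` A))"
      using diff_card_le_card_Diff[of "A \<union> \<tau> ` A" V] fA big by simp
    then obtain C where C: "C \<subseteq> V - (A \<union> \<tau> ` A)" "card C = card A"
      by (meson obtain_subset_with_card_n)
    have "perm_prob V (\<lambda>\<pi>. F (\<pi> ` A) \<and> \<not> F ((\<pi> \<circ> \<tau>) ` A))
        \<le> perm_avg V (\<lambda>\<pi>. of_bool (F (\<pi> ` A) \<and> \<not> F (\<pi> ` C)) + of_bool (F (\<pi> ` C) \<and> \<not> F (\<pi> ` \<tau> ` A)))"
      by (intro perm_avg_mono) (auto simp: of_bool_def image_comp)
    also have "\<dots> = perm_prob V (\<lambda>\<pi>. F (\<pi> ` A) \<and> \<not> F (\<pi> ` C))
        + perm_prob V (\<lambda>\<pi>. F (\<pi> ` C) \<and> \<not> F (\<pi> ` \<tau> ` A))"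
      by (rule perm_avg_add)
    also have "perm_prob V (\<lambda>\<pi>. F (\<pi> ` A) \<and> \<not> F (\<pi> ` C)) = ?d"
      by (rule perm_prob_disjoint_pair[OF fin, where P="\<lambda>X Y. F X \<and> \<not> F Y"]) (use AB C in auto)
    also have "perm_prob V (\<lambda>\<pi>. F (\<pi> ` C) \<and> \<not> F (\<pi> ` \<tau> ` A)) = ?d"
      by (rule perm_prob_disjoint_pair[OF fin, where P="\<lambda>X Y. F X \<and> \<not> F Y"]) (use AB C tA ctA in auto)
    finally show ?thesis by simp
  qed
  \<comment> \<open>For fixed \<pi> the composition of \<pi> with a uniform \<tau> is again uniform,
    so the two images of \<open>A\<close> behave as independent sets. Swapping the averages then
    reduces to the bound for fixed \<tau>.\<close>
  have "q * (1 - q) = perm_avg V (\<lambda>\<pi>. of_bool (F (\<pi> ` A)) * (1 - q))"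
    using perm_avg_cmult[of V "1 - q" "\<lambda>\<pi>. of_bool (F (\<pi> ` A))"] by (simp add: q mult.commute)
  also have "\<dots> = perm_avg V (\<lambda>\<pi>. perm_avg V (\<lambda>\<tau>. of_bool (F (\<pi> ` A) \<and> \<not> F ((\<pi> \<circ> \<tau>) ` A))))"
  proof (rule perm_avg_cong)
    fix \<pi> assume \<pi>: "\<pi> permutes V"
    have "1 - q = perm_prob V (\<lambda>\<tau>. \<not> F (\<tau> ` A))" unfolding q by (rule perm_prob_not[OF fin, symmetric])
    also have "\<dots> = perm_prob V (\<lambda>\<tau>. \<not> F ((\<pi> \<circ> \<tau>) ` A))"
      using perm_avg_compose_left[OF \<pi>, of "\<lambda>\<tau>. of_bool (\<not> F (\<tau> ` A))"] by simp
    finally show "of_bool (F (\<pi> ` A)) * (1 - q) = perm_avg V (\<lambda>\<tau>. of_bool (F (\<pi> ` A) \<and> \<not> F ((\<pi> \<circ> \<tau>) ` A)))"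
      by (cases "F (\<pi> ` A)") (simp_all add: perm_avg_const[OF fin])
  qed
  also have "\<dots> = perm_avg V (\<lambda>\<tau>. perm_prob V (\<lambda>\<pi>. F (\<pi> ` A) \<and> \<not> F ((\<pi> \<circ> \<tau>) ` A)))"
    by (rule perm_avg_swap)
  also have "\<dots> \<le> perm_avg V (\<lambda>\<tau>. 2 * ?d)" by (intro perm_avg_mono *)
  finally show ?thesis by (simp add: perm_avg_const[OF fin])
qed

lemma card_partition_obtain:
  assumes "finite V" "card V = t + M * k + l"
  obtains T A R where "V = T \<union> (\<Union>i<M. A i) \<union> R" "card T = t" "card R = l"
    "\<And>i. i < M \<Longrightarrow> card (A i) = k" "T \<inter> R = {}"
    "\<And>i. i < M \<Longrightarrow> A i \<inter> T = {}" "\<And>i. i < M \<Longrightarrow> A i \<inter> R = {}"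
    "\<And>i j. i < M \<Longrightarrow> j < M \<Longrightarrow> i \<noteq> j \<Longrightarrow> A i \<inter> A j = {}"
  using assms
proof (induction M arbitrary: V thesis)
  case 0
  then obtain T where "T \<subseteq> V" "card T = t" by (metis add_leD1 le_refl obtain_subset_with_card_n)
  then show ?case
    using 0(1)[of T "\<lambda>_. {}" "V - T"] 0(2,3) finite_subset[of T V] by (auto simp: card_Diff_subset)
next
  case (Suc M)
  then obtain B where B: "B \<subseteq> V" "card B = k" by (metis add_leD1 add.commute le_refl mult_Suc obtain_subset_with_card_n add.assoc)
  have fB: "finite B" using B Suc.prems finite_subset by blast
  then have "card (V - B) = t + M * k + l" using B Suc.prems by (simp add: card_Diff_subset)
  then obtain T A R where *: "V - B = T \<union> (\<Union>i<M. A i) \<union> R" "card T = t" "card R = l"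
    "\<And>i. i < M \<Longrightarrow> card (A i) = k" "T \<inter> R = {}"
    "\<And>i. i < M \<Longrightarrow> A i \<inter> T = {}" "\<And>i. i < M \<Longrightarrow> A i \<inter> R = {}"
    "\<And>i j. i < M \<Longrightarrow> j < M \<Longrightarrow> i \<noteq> j \<Longrightarrow> A i \<inter> A j = {}"
    using Suc.IH[of "V - B"] Suc.prems(2) by blast
  define A' where "A' = A(M := B)"
  have un: "(\<Union>i<Suc M. A' i) = (\<Union>i<M. A i) \<union> B" by (auto simp: A'_def lessThan_Suc)
  have disj: "B \<inter> T = {}" "B \<inter> R = {}" "\<And>i. i < M \<Longrightarrow> B \<inter> A i = {}" using *(1) by auto
  have A': "A' i = (if i = M then B else A i)" for i by (simp add: A'_def)
  have VB: "V = (V - B) \<union> B" using B(1) by blast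
  show ?case
  proof (rule Suc.prems(1)[of T A' R])
    show "V = T \<union> (\<Union>i<Suc M. A' i) \<union> R"
      by (subst VB) (simp only: un *(1) Un_ac)
    show "card (A' i) = k" if "i < Suc M" for i
      using that *(4)[of i] B(2) by (simp add: A')
    show "A' i \<inter> T = {}" if "i < Suc M" for i
      using that *(6)[of i] disj(1) by (simp add: A')
    show "A' i \<inter> R = {}" if "i < Suc M" for i
      using that *(7)[of i] disj(2) by (simp add: A')
    show "A' i \<inter> A' j = {}" if "i < Suc M" "j < Suc M" "i \<noteq> j" for i j
      using that *(8)[of i j] disj(3)[of i] disj(3)[of j]
      by (cases "i = M"; cases "j = M") (simp_all add: A' Int_commute[of _ B])
  qed (simp_all add: *(2,3,5))
qed

text \<open>Here \<open>V\<close> is the ground set without the maximum and \<open>b\<close> is the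
  maximal value. A plain union bound would give only q/(M + 10^6). The missing factor comes from
  \<open>E\<close>, which counts nonnegative blocks seen when only the first of two disjoint
  (k-1)-sets is bad.\<close>

lemma removal_bound:
  fixes V :: "'a set" and x :: "'a \<Rightarrow> real" and b :: real
  assumes fin: "finite V" and k: "k > 0" and M: "M \<ge> 10 ^ 45"
    and l: "1000 * k \<le> l" "l \<le> 1001 * k" and cV: "card V = (k - 1) + M * k + l"
    and sum0: "b + sum x V \<ge> 0"
    and good: "C \<subseteq> V" "card C = k - 1" "q = perm_prob V (\<lambda>\<pi>. b + sum x (\<pi> ` C) < 0)" "1 - q \<ge> 1 / 800"
    and K: "K \<subseteq> V" "card K = k"
  shows "q / M \<le> perm_prob V (\<lambda>\<pi>. sum x (\<pi> ` K) \<ge> 0)"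
proof -
  obtain T A R where V: "V = T \<union> (\<Union>i<M. A i) \<union> R" and card: "card T = k - 1" "card R = l"
    "\<And>i. i < M \<Longrightarrow> card (A i) = k" and disj: "T \<inter> R = {}"
    "\<And>i. i < M \<Longrightarrow> A i \<inter> T = {}" "\<And>i. i < M \<Longrightarrow> A i \<inter> R = {}"
    "\<And>i j. i < M \<Longrightarrow> j < M \<Longrightarrow> i \<noteq> j \<Longrightarrow> A i \<inter> A j = {}"
    using card_partition_obtain[OF fin cV] by blast
  have M2: "0 < M" "1 < M" using M by auto
  have A1: "A 1 \<subseteq> V" "A 1 \<inter> T = {}" "card (A 1) = k" "A 1 \<inter> A 0 = {}"
    using V card(3)[OF M2(2)] disj(2)[OF M2(2)] disj(4)[OF M2(2,1)] M2 by auto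
  have sub: "T \<subseteq> V" "R \<subseteq> V" "\<And>i. i < M \<Longrightarrow> A i \<subseteq> V" using V by auto
  have finA: "finite (A i)" if "i < M" for i using sub(3)[OF that] fin by (rule finite_subset)
  have finR: "finite R" using sub fin finite_subset by blast
  \<comment> \<open>Placing \<open>T'\<close> inside block 0 keeps all other blocks disjoint from
    both \<open>T\<close> and \<open>T'\<close>.\<close>
  obtain T' where T': "T' \<subseteq> A 0" "card T' = k - 1"
    using obtain_subset_with_card_n[of "k - 1" "A 0"] card(3)[OF M2(1)] by auto
  have T'V: "T' \<subseteq> V" "T \<inter> T' = {}" using T' sub(3)[OF M2(1)] disj(2)[OF M2(1)] by auto
  define bad where "bad = (\<lambda>S. b + sum x S < 0)"
  define pos where "pos = (\<lambda>S. sum x S \<ge> 0)"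
  define U where "U = perm_prob V (\<lambda>\<pi>. bad (\<pi> ` T) \<and> pos (\<pi> ` A 1))"
  define r where "r = perm_prob V (\<lambda>\<pi>. bad (\<pi> ` T) \<and> pos (\<pi> ` R))"
  define E where "E = perm_prob V (\<lambda>\<pi>. bad (\<pi> ` T) \<and> \<not> bad (\<pi> ` T') \<and> pos (\<pi> ` A 1))"
  have nn: "U \<ge> 0" "E \<ge> 0" "r \<ge> 0" unfolding U_def E_def r_def by (simp_all add: perm_avg_nonneg)
  have q: "q = perm_prob V (\<lambda>\<pi>. bad (\<pi> ` T))"
    unfolding good(3) bad_def by (rule perm_prob_image_cong[OF fin]) (use good sub card in auto)
  have Ueq: "perm_prob V (\<lambda>\<pi>. bad (\<pi> ` T) \<and> pos (\<pi> ` W)) = U"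
    if "W \<subseteq> V" "W \<inter> T = {}" "card W = k" for W
    unfolding U_def
    by (rule perm_prob_disjoint_pair[OF fin, where P="\<lambda>X Y. bad X \<and> pos Y"])
      (use that sub(1) A1 in auto)
  \<comment> \<open>Since b + x(V) \<ge> 0 and b + x(\<pi>T) < 0, the blocks and the rest have
    positive total, so they cannot all be negative.\<close>
  have total: "\<exists>i<M. pos (\<pi> ` A i)" if "\<pi> permutes V" "bad (\<pi> ` T)" "\<not> pos (\<pi> ` R)" for \<pi>
  proof (rule ccontr)
    assume neg: "\<not> (\<exists>i<M. pos (\<pi> ` A i))"
    have "sum x V = (\<Sum>i\<in>V. x (\<pi> i))" by (simp add: sum_permutes[OF that(1)])
    also have "\<dots> = (\<Sum>i\<in>T \<union> (\<Union>i<M. A i). x (\<pi> i)) + (\<Sum>i\<in>R. x (\<pi> i))"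
      unfolding V using disj(1) disj(3) fin[unfolded V] by (intro sum.union_disjoint) (simp, simp, blast)
    also have "(\<Sum>i\<in>T \<union> (\<Union>i<M. A i). x (\<pi> i)) = (\<Sum>i\<in>T. x (\<pi> i)) + (\<Sum>i\<in>(\<Union>i<M. A i). x (\<pi> i))"
      using disj(2) fin[unfolded V] by (intro sum.union_disjoint) (simp, simp, blast)
    also have "(\<Sum>i\<in>(\<Union>i<M. A i). x (\<pi> i)) = (\<Sum>j<M. \<Sum>i\<in>A j. x (\<pi> i))"
      using disj(4) finA by (intro sum.UNION_disjoint) auto
    also have "\<dots> \<le> 0"
      by (rule sum_nonpos) (use neg in \<open>auto simp: pos_def sum_image_permutes[OF that(1)] not_le less_imp_le\<close>)
    finally show False
      using that sum0 by (auto simp: bad_def pos_def sum_image_permutes[OF that(1)])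
  qed
  \<comment> \<open>If the rest is nonnegative, the weak bound applied to the values at the
    positions \<open>R\<close> makes at least a 10^(-6) proportion of the k-subsets of
    \<open>R\<close> nonnegative. Each such subset is disjoint from \<open>T\<close> and contributes
    probability \<open>U\<close>.\<close>
  have r_le: "r \<le> 10 ^ 6 * U"
  proof -
    let ?W = "{W. W \<subseteq> R \<and> card W = k}"
    have le: "perm_avg V (\<lambda>\<pi>. real (l choose k) * of_bool (bad (\<pi> ` T) \<and> pos (\<pi> ` R)))
        \<le> perm_avg V (\<lambda>\<pi>. 10 ^ 6 * (\<Sum>W\<in>?W. of_bool (bad (\<pi> ` T) \<and> pos (\<pi> ` W))))"
    proof (rule perm_avg_mono)
      fix \<pi> assume \<pi>: "\<pi> permutes V"
      show "real (l choose k) * of_bool (bad (\<pi> ` T) \<and> pos (\<pi> ` R))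
          \<le> 10 ^ 6 * (\<Sum>W\<in>?W. of_bool (bad (\<pi> ` T) \<and> pos (\<pi> ` W)) :: real)"
      proof (cases "bad (\<pi> ` T) \<and> pos (\<pi> ` R)")
        case True
        have "(l choose k) \<le> 10 ^ 6 * card {S. S \<subseteq> R \<and> card S = k \<and> (\<Sum>i\<in>S. x (\<pi> i)) \<ge> 0}"
          using nonneg_subsets_weak_bound[OF finR k, of "\<lambda>i. x (\<pi> i)"] card l True
          by (simp add: pos_def sum_image_permutes[OF \<pi>])
        also have "{S. S \<subseteq> R \<and> card S = k \<and> (\<Sum>i\<in>S. x (\<pi> i)) \<ge> 0} = ?W \<inter> {W. pos (\<pi> ` W)}"
          by (auto simp: pos_def sum_image_permutes[OF \<pi>])
        finally have "real (l choose k) \<le> real (10 ^ 6 * card (?W \<inter> {W. pos (\<pi> ` W)}))"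
          by (rule of_nat_mono)
        moreover have "finite ?W" using finR by (auto intro: finite_subset[of _ "Pow R"])
        ultimately show ?thesis using True by (simp add: sum_of_bool_eq)
      qed (auto simp: sum_nonneg)
    qed
    have eq: "perm_avg V (\<lambda>\<pi>. 10 ^ 6 * (\<Sum>W\<in>?W. of_bool (bad (\<pi> ` T) \<and> pos (\<pi> ` W))))
        = 10 ^ 6 * (\<Sum>W\<in>?W. U)"
      unfolding perm_avg_cmult perm_avg_sum
      by (intro arg_cong2[where f="(*)"] sum.cong refl Ueq) (use sub disj in auto)
    have "(l choose k) * r \<le> (l choose k) * (10 ^ 6 * U)"
      using le[unfolded eq, unfolded perm_avg_cmult] n_subsets[OF finR, of k] card(2) by (simp add: r_def mult_ac)
    moreover have "l choose k > 0" using l k by (intro zero_less_binomial) auto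
    ultimately show ?thesis by simp
  qed
  have q_le: "q \<le> M * U + r"
  proof -
    have "q \<le> perm_avg V (\<lambda>\<pi>. (\<Sum>i<M. of_bool (bad (\<pi> ` T) \<and> pos (\<pi> ` A i))) + of_bool (bad (\<pi> ` T) \<and> pos (\<pi> ` R)))"
      unfolding q
    proof (rule perm_avg_mono)
      fix \<pi> assume \<pi>: "\<pi> permutes V"
      show "of_bool (bad (\<pi> ` T)) \<le> (\<Sum>i<M. of_bool (bad (\<pi> ` T) \<and> pos (\<pi> ` A i))) + (of_bool (bad (\<pi> ` T) \<and> pos (\<pi> ` R)) :: real)"
      proof (cases "bad (\<pi> ` T) \<and> \<not> pos (\<pi> ` R)")
        case True
        then obtain i where i: "i < M" "pos (\<pi> ` A i)" using total \<pi> by blast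
        then have "of_bool (bad (\<pi> ` T) \<and> pos (\<pi> ` A i)) \<le> (\<Sum>i<M. of_bool (bad (\<pi> ` T) \<and> pos (\<pi> ` A i)) :: real)"
          by (intro member_le_sum) auto
        then show ?thesis using True i by simp
      qed (auto simp: sum_nonneg)
    qed
    also have "\<dots> = (\<Sum>i<M. U) + r"
      unfolding perm_avg_add perm_avg_sum r_def
      by (intro arg_cong2[where f="(+)"] sum.cong refl Ueq) (use sub disj card in auto)
    finally show ?thesis by simp
  qed
  \<comment> \<open>Block 0 meets \<open>T'\<close> and so cannot be counted by \<open>E\<close>.
    For it, as for the rest, the condition on \<open>T'\<close> is dropped, at the cost of
    \<open>U\<close> and \<open>r\<close>.\<close>
  have sep: "q * (1 - q) / 2 \<le> (real M - 1) * E + U + r"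
  proof -
    have "q * (1 - q) / 2 \<le> perm_prob V (\<lambda>\<pi>. bad (\<pi> ` T) \<and> \<not> bad (\<pi> ` T'))"
    proof (rule perm_prob_disjoint_separate[OF fin sub(1) T'V])
      show "3 * card T \<le> card V" using card l cV by simp
    qed (use card T' q in auto)
    also have "\<dots> \<le> perm_avg V (\<lambda>\<pi>. (\<Sum>i\<in>{1..<M}. of_bool (bad (\<pi> ` T) \<and> \<not> bad (\<pi> ` T') \<and> pos (\<pi> ` A i)))
        + of_bool (bad (\<pi> ` T) \<and> pos (\<pi> ` A 0)) + of_bool (bad (\<pi> ` T) \<and> pos (\<pi> ` R)))"
    proof (rule perm_avg_mono)
      fix \<pi> assume \<pi>: "\<pi> permutes V"
      show "of_bool (bad (\<pi> ` T) \<and> \<not> bad (\<pi> ` T')) \<le> (\<Sum>i\<in>{1..<M}. of_bool (bad (\<pi> ` T) \<and> \<not> bad (\<pi> ` T') \<and> pos (\<pi> ` A i)))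
        + of_bool (bad (\<pi> ` T) \<and> pos (\<pi> ` A 0)) + (of_bool (bad (\<pi> ` T) \<and> pos (\<pi> ` R)) :: real)"
      proof (cases "bad (\<pi> ` T) \<and> \<not> bad (\<pi> ` T') \<and> \<not> pos (\<pi> ` R) \<and> \<not> pos (\<pi> ` A 0)")
        case True
        then obtain i where i: "i < M" "pos (\<pi> ` A i)" using total \<pi> by blast
        have "i \<noteq> 0" using i True by metis
        then have "of_bool (bad (\<pi> ` T) \<and> \<not> bad (\<pi> ` T') \<and> pos (\<pi> ` A i))
            \<le> (\<Sum>i\<in>{1..<M}. of_bool (bad (\<pi> ` T) \<and> \<not> bad (\<pi> ` T') \<and> pos (\<pi> ` A i)) :: real)"
          using i by (intro member_le_sum) auto
        then show ?thesis using True i by simp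
      qed (auto simp: sum_nonneg)
    qed
    also have "\<dots> = (\<Sum>i\<in>{1..<M}. E) + U + r"
      unfolding perm_avg_add perm_avg_sum r_def
    proof (intro arg_cong2[where f="(+)"] sum.cong refl)
      show "perm_prob V (\<lambda>\<pi>. bad (\<pi> ` T) \<and> pos (\<pi> ` A 0)) = U"
        by (rule Ueq) (use sub disj card M2 in auto)
      fix i assume i: "i \<in> {1..<M}"
      have "A i \<subseteq> V - (T \<union> T')" if "0 < i" "i < M" for i
        using that sub(3)[of i] disj(2)[of i] disj(4)[of i 0] T'(1) by auto
      then show "perm_prob V (\<lambda>\<pi>. bad (\<pi> ` T) \<and> \<not> bad (\<pi> ` T') \<and> pos (\<pi> ` A i)) = E"
        unfolding E_def using i M2 card sub T'V
        by (intro perm_prob_disjoint_triple[OF fin, where P="\<lambda>X Y Z. bad X \<and> \<not> bad Y \<and> pos Z"]) auto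
    qed
    finally show ?thesis using M2 by (simp add: of_nat_diff)
  qed
  \<comment> \<open>By symmetry \<open>U\<close> may be computed with \<open>T'\<close> in place of
    \<open>T\<close>. Its event is then disjoint from that of \<open>E\<close>, and both imply that
    block 1 is nonnegative.\<close>
  have "U + E = perm_avg V (\<lambda>\<pi>. of_bool (bad (\<pi> ` T') \<and> pos (\<pi> ` A 1))
          + of_bool (bad (\<pi> ` T) \<and> \<not> bad (\<pi> ` T') \<and> pos (\<pi> ` A 1)))"
  proof -
    have "U = perm_prob V (\<lambda>\<pi>. bad (\<pi> ` T') \<and> pos (\<pi> ` A 1))" unfolding U_def
      by (rule perm_prob_disjoint_pair[OF fin, where P="\<lambda>X Y. bad X \<and> pos Y"])
        (use sub(1) A1 card(1) T' T'V in auto)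
    then show ?thesis by (simp add: perm_avg_add E_def)
  qed
  also have "\<dots> \<le> perm_prob V (\<lambda>\<pi>. pos (\<pi> ` A 1))"
    by (intro perm_avg_mono) (auto simp: of_bool_def)
  also have "\<dots> = perm_prob V (\<lambda>\<pi>. pos (\<pi> ` K))"
    by (rule perm_prob_image_cong[OF fin]) (use A1 K in auto)
  finally have UE: "U + E \<le> perm_prob V (\<lambda>\<pi>. pos (\<pi> ` K))" .
  define m where "m = real M"
  have m: "m \<ge> 10 ^ 45" using of_nat_mono[OF M, where 'a=real] by (simp add: m_def)
  have q0: "q \<ge> 0" unfolding q by (simp add: perm_avg_nonneg)
  have UQ: "q \<le> (m + 10 ^ 6) * U" using q_le r_le by (simp add: m_def algebra_simps)
  have "q * (1 / 800) \<le> q * (1 - q)" using good(4) q0 by (intro mult_left_mono) auto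
  then have EQ: "q / 1600 \<le> (m - 1) * E + (1 + 10 ^ 6) * U" using sep r_le by (simp add: m_def)
  have "(m - 1) * (q / m) \<le> q" using m q0 by (simp add: field_simps)
  \<comment> \<open>The loss from the union bound is of order 10^6/m, and for m \<ge> 10^45 it is
    covered by the gain q/1600 coming from \<open>E\<close>.\<close>
  also have "q \<le> (1 - (2 + 2 * 10 ^ 6) / (m + 10 ^ 6)) * q + q / 1600"
  proof -
    have "(2 + 2 * 10 ^ 6) / (m + 10 ^ 6) \<le> 1 / 1600" using m by (simp add: field_simps)
    then have "(2 + 2 * 10 ^ 6) / (m + 10 ^ 6) * q \<le> 1 / 1600 * q" using q0 by (rule mult_right_mono)
    then show ?thesis by (simp add: algebra_simps)
  qed
  also have "(1 - (2 + 2 * 10 ^ 6) / (m + 10 ^ 6)) * q \<le> (m - 2 - 10 ^ 6) * U"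
  proof -
    have "(1 - (2 + 2 * 10 ^ 6) / (m + 10 ^ 6)) = (m - 2 - 10 ^ 6) * (1 / (m + 10 ^ 6))"
      using m by (simp add: field_simps)
    moreover have "1 / (m + 10 ^ 6) * q \<le> U" using UQ m by (simp add: field_simps)
    ultimately show ?thesis using m mult_left_mono[of "1 / (m + 10 ^ 6) * q" U "m - 2 - 10 ^ 6"] by simp
  qed
  also have "(m - 2 - 10 ^ 6) * U + q / 1600 \<le> (m - 1) * (U + E)"
    using EQ by (simp add: algebra_simps)
  finally have "(m - 1) * (q / m) \<le> (m - 1) * (U + E)" by simp
  moreover have "m - 1 > 0" using m by simp
  ultimately have "q / m \<le> U + E" by (simp only: mult_le_cancel_left_pos)
  then show ?thesis using UE by (simp add: m_def pos_def)
qed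

section \<open>Counting nonnegative sets with and without the maximum\<close>

theorem theorem1:
  fixes k n :: nat and x :: "nat \<Rightarrow> real"
  assumes "k > 0" and "n > 0"
    and "n \<ge> 10 ^ 46 * k"
    and "(\<Sum>i = 1..n. x i) \<ge> 0"
  shows "card {A. A \<subseteq> {1..n} \<and> card A = k \<and> (\<Sum>a\<in>A. x a) \<ge> 0} \<ge> (n - 1) choose (k - 1)"
    (is "card ?S \<ge> _")
proof -
  define W where "W = {1..n}"
  have W: "finite W" "card W = n" "W \<noteq> {}" using assms(2) by (auto simp: W_def)
  obtain z where z: "z \<in> W" "\<And>i. i \<in> W \<Longrightarrow> x i \<le> x z"
    using finite_ex_maximizer[OF W(1,3), of x] by blast
  define V where "V = W - {z}"
  have V: "finite V" "card V = n - 1" "z \<notin> V" "V \<subseteq> W" using W z by (auto simp: V_def)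
  have absorb: "k * (n choose k) = n * ((n - 1) choose (k - 1))"
    using binomial_absorption[of "k - 1" n] assms(1) by simp
  have big: "1000 * k \<le> card W" using assms(3) W by simp
  have sW: "sum x W \<ge> 0" using assms(4) by (simp add: W_def)
  define G where "G = {T. T \<subseteq> V \<and> card T = k - 1 \<and> x z + sum x T \<ge> 0}"
  consider "(n choose k) \<le> 5000 * card ?S" | "((n - 1) choose (k - 1)) \<le> 800 * card G"
    using many_nonneg_or_popular_max[OF W(1) assms(1) big sW z] unfolding W(2) by (auto simp: G_def W_def V_def)
  then show ?thesis
  proof cases
    case 1
    \<comment> \<open>A constant proportion of all k-sets suffices: the target is only a fraction
      k/n of them, and 5000 k \<le> n.\<close>
    have "n * ((n - 1) choose (k - 1)) \<le> k * (5000 * card ?S)"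
      using 1 unfolding absorb[symmetric] by (rule mult_le_mono2)
    also have "\<dots> \<le> n * card ?S" using mult_le_mono1[of "5000 * k" n "card ?S"] assms(3) by (simp add: mult_ac)
    finally show ?thesis using assms(2) by simp
  next
    case 2
    \<comment> \<open>Chosen so that the n - 1 remaining elements split into a (k-1)-set,
      \<open>M\<close> blocks of size \<open>k\<close>, and a rest whose size \<open>l\<close> lies
      between 1000 k and 1001 k.\<close>
    define M where "M = n div k - 1001"
    define l where "l = 1000 * k + n mod k"
    have "10 ^ 46 \<le> n div k" using assms(1,3) by (simp add: less_eq_div_iff_mult_less_eq)
    then have M: "10 ^ 45 \<le> M" and Mn: "n div k = M + 1001" unfolding M_def by simp_all
    have n: "n = (M + 1001) * k + n mod k" using div_mult_mod_eq[of n k] Mn by simp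
    have cV: "card V = (k - 1) + M * k + l"
      using V(2) n assms(1) unfolding l_def by (simp add: algebra_simps)
    obtain C where C: "C \<subseteq> V" "card C = k - 1" using obtain_subset_with_card_n[of "k - 1" V] cV by auto
    obtain K where K: "K \<subseteq> V" "card K = k" using obtain_subset_with_card_n[of k V] cV
      by (auto simp: l_def)
    define q where "q = perm_prob V (\<lambda>\<pi>. x z + sum x (\<pi> ` C) < 0)"
    have "1 - q = perm_prob V (\<lambda>\<pi>. \<not> x z + sum x (\<pi> ` C) < 0)"
      unfolding q_def by (rule perm_prob_not[OF V(1), symmetric])
    then have G: "(1 - q) * ((n - 1) choose (k - 1)) = card G"
      using perm_prob_image[OF V(1) C(1), of "\<lambda>S. x z + sum x S \<ge> 0"] C V(2) by (simp add: G_def not_less)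
    have cpos: "real ((n - 1) choose (k - 1)) > 0" using C V card_mono[OF V(1) C(1)] by simp
    have "real ((n - 1) choose (k - 1)) \<le> 800 * real (card G)" using 2 by linarith
    then have "1 / 800 * real ((n - 1) choose (k - 1)) \<le> (1 - q) * real ((n - 1) choose (k - 1))"
      using G by simp
    then have q: "1 / 800 \<le> 1 - q" using cpos by (simp only: mult_le_cancel_right_pos)
    have sV: "x z + sum x V \<ge> 0" using sW sum.remove[OF W(1) z(1), of x] by (simp add: V_def)
    define H where "H = {S. S \<subseteq> V \<and> card S = k \<and> sum x S \<ge> 0}"
    have "q / M \<le> perm_prob V (\<lambda>\<pi>. sum x (\<pi> ` K) \<ge> 0)"
      by (rule removal_bound[OF V(1) assms(1) M _ _ cV sV C q_def q K]) (auto simp: l_def assms(1) less_imp_le)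
    then have "q / M * ((n - 1) choose k) \<le> perm_prob V (\<lambda>\<pi>. sum x (\<pi> ` K) \<ge> 0) * ((n - 1) choose k)"
      by (rule mult_right_mono) simp
    also have "\<dots> = card H" 
      using perm_prob_image[OF V(1) K(1), of "\<lambda>S. sum x S \<ge> 0"] K V(2) by (simp add: H_def)
    finally have H: "q / M * ((n - 1) choose k) \<le> card H" .
    \<comment> \<open>The ratio of the two binomials is (n - k)/k \<ge> M. So the sets avoiding
      \<open>z\<close> supply the fraction \<open>q\<close> of the target that those through
      \<open>z\<close> leave open.\<close>
    have "q * ((n - 1) choose (k - 1)) \<le> q / M * ((n - 1) choose k)"
    proof -
      have "k * ((n - 1) choose k) = (n - k) * ((n - 1) choose (k - 1))"
      proof -
        have "n * (k * ((n - 1) choose k)) = k * ((n - k) * (n choose k))"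
          by (simp add: binomial_absorb_comp)
        also have "\<dots> = n * ((n - k) * ((n - 1) choose (k - 1)))"
          using absorb by (simp add: mult.left_commute)
        finally show ?thesis using assms(2) by simp
      qed
      moreover have "M * k \<le> n - k" using n by (simp add: algebra_simps)
      ultimately have "(M * k) * ((n - 1) choose (k - 1)) \<le> k * ((n - 1) choose k)" by simp
      then have "M * ((n - 1) choose (k - 1)) \<le> (n - 1) choose k" using assms(1) by (simp add: mult_ac)
      then have "real M * ((n - 1) choose (k - 1)) \<le> (n - 1) choose k"
        by (metis of_nat_le_iff of_nat_mult)
      moreover have "q \<ge> 0" unfolding q_def by (simp add: perm_avg_nonneg)
      moreover have "real M > 0" using M by simp
      ultimately show ?thesis
        using mult_left_mono[of "real M * ((n - 1) choose (k - 1))" "(n - 1) choose k" "q / M"] by simp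
    qed
    then have "real ((n - 1) choose (k - 1)) \<le> card G + card H"
      using G H by (simp add: algebra_simps)
    then have GH: "(n - 1) choose (k - 1) \<le> card G + card H" by linarith
    have finT: "finite T" if "T \<subseteq> V" for T using that V finite_subset by blast
    have "inj_on (insert z) G" 
      using V(3) unfolding G_def by (intro inj_onI) (metis (no_types, lifting) insert_ident mem_Collect_eq subsetD)
    then have "card G = card (insert z ` G)" by (simp add: card_image)
    moreover have "finite G" "finite H" using V(1) by (auto simp: G_def H_def intro: finite_subset[of _ "Pow V"])
    moreover have "insert z ` G \<inter> H = {}" using V(3) by (auto simp: H_def)
    ultimately have "card G + card H = card (insert z ` G \<union> H)" by (simp add: card_Un_disjoint)
    also have "\<dots> \<le> card ?S"
    proof (rule card_mono)
      show "finite ?S" by (auto intro: finite_subset[of _ "Pow {1..n}"])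
      have "insert z T \<in> ?S" if T: "T \<in> G" for T
      proof -
        have "z \<notin> T" "finite T" using T finT V(3) by (auto simp: G_def)
        then show ?thesis using T z(1) assms(1) V(4) by (auto simp: G_def W_def)
      qed
      then show "insert z ` G \<union> H \<subseteq> ?S" using V(4) by (auto simp: H_def W_def)
    qed
    finally show ?thesis using GH by linarith
  qed
qed

end
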